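(* Let $k$ be an algebraically closed field of characteristic zero. Let $A$ be a finite-dimensional semi-simple associative unital $k$-algebra (the algebra corresponding to a two-dimensional lattice topological field theory), let $X$ be a finite alphabet and let $S:X^*\to k$ be a formal power series over $X$ whose syntactic algebra $\mathfrak{A}_S$ is $A$ (i.e. $\mathfrak{A}_S\cong A$ as $k$-algebras). Then $S$ is $\operatorname{rwMSO}(k,X)$-definable, i.e. definable in restricted weighted monadic second order logic over $k$.
   Context: Lattice topological field theories (LTFTs) in dimension two are identified with finite-dimensional semi-simple $k$-algebras, i.e. algebras $A\cong M_{n_1}(k)\times\dots\times M_{n_r}(k)$ with $r,n_i\geq 1$; "every LTFT is rwMSO($k$)-definable" means the statement of the claim. Syntactic algebra: for a finite set $X$, $X^*$ is the free monoid and $k\langle X\rangle$ the free associative unital $k$-algebra on $X$. A formal series $S:X^*\to k$ extends linearly to $S:k\langle X\rangle\to k$; $I_S$ is the largest two-sided ideal of $k\langle X\rangle$ contained in $\ker(S)$, and $\mathfrak{A}_S:=k\langle X\rangle/I_S$. Restricted weighted MSO (in the sense of Droste and Gastin). Formulas of weighted MSO over $k$ and $X$ are generated by $$\varphi::= c\mid P_a(x)\mid\neg P_a(x)\mid x\le y\mid\neg(x\le y)\mid x\in Z\mid\neg(x\in Z)\mid\varphi\vee\psi\mid\varphi\wedge\psi\mid\exists x.\varphi\mid\exists Z.\varphi\mid\forall x.\varphi\mid\forall Z.\varphi,$$ with $c\in k$, $a\in X$, $x,y$ first-order variables and $Z$ a set variable. For a word $w=w_1\cdots w_n\in X^*$,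 first-order variables range over positions in $\{1,\dots,n\}$ and set variables over subsets of $\{1,\dots,n\}$. Given an assignment $\sigma$ of the free variables, the value $[\![\varphi]\!](w,\sigma)\in k$ is defined inductively: a constant $c$ has value $c$; an atomic formula or negated atomic formula ($P_a(x)$ means that position $x$ carries letter $a$) has value $1$ if it holds and $0$ otherwise; $\vee$ is the sum and $\wedge$ the product in $k$; $\exists x$ and $\exists Z$ are the sums over all positions, respectively all subsets of positions; $\forall x$ and $\forall Z$ are the products over all positions, respectively all subsets (empty sum $=0$, empty product $=1$). Pairs $(w,\sigma)$, for a formula with free variable set $V$, are encoded as words over $X\times\{0,1\}^V$ (each variable being encoded by the characteristic function of its value), and $[\![\varphi]\!]$ is viewed as a series over this alphabet, with value $0$ on words that do not encode an assignment. A series is a recognisable step function if it is a finite sum $\sum_j c_j\chi_{L_j}$ with $c_j\in k$ and $\chi_{L_j}$ the characteristic series of regular languages $L_j$. A formula is restricted if it contains no universal set quantifier $\forall Z$ and, for each subformula $\forall x.\psi$, the series $[\![\psi]\!]$ is a recognisable step function. A series $S:X^*\to k$ is $\operatorname{rwMSO}(k,X)$-definable if there is a restricted formula $\varphi$ without free variables with $S_w=[\![\varphi]\!](w)$ for all $w\in X^*$. *)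

theory Defs
  imports
    "HOL-Algebra.QuotRing"
    "HOL-Library.Poly_Mapping"
    "HOL-Library.Indicator_Function"
    "Jordan_Normal_Form.VS_Connect"
begin

section \<open>Algebras over a field\<close>

text \<open>
  The base field is a type. The locale \<^locale>\<open>algebra\<close> of HOL-Algebra only covers commutative
  algebras, hence the following variant for associative unital algebras.
\<close>

locale assoc_algebra = ring A + scalars: Module.module "class_ring :: 'k ring" A
  for A :: "('k :: field, 'a) module" (structure) +
  assumes smult_mult_left:
      "x \<in> carrier A \<Longrightarrow> y \<in> carrier A \<Longrightarrow> (c \<odot> x) \<otimes> y = c \<odot> (x \<otimes> y)"
    and smult_mult_right:
      "x \<in> carrier A \<Longrightarrow> y \<in> carrier A \<Longrightarrow> x \<otimes> (c \<odot> y) = c \<odot> (x \<otimes> y)"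

definition algebra_isomorphic :: "('k, 'a) module \<Rightarrow> ('k, 'b) module \<Rightarrow> bool" where
  "algebra_isomorphic A B \<longleftrightarrow>
     (\<exists>h \<in> ring_iso A B. \<forall>c. \<forall>x \<in> carrier A. h (c \<odot>\<^bsub>A\<^esub> x) = c \<odot>\<^bsub>B\<^esub> h x)"

definition matrix_product_algebra :: "nat list \<Rightarrow> ('k :: field, nat \<Rightarrow> 'k mat) module" where
  "matrix_product_algebra ns =
     \<lparr> carrier = (\<Pi>\<^sub>E i \<in> {..<length ns}. carrier_mat (ns ! i) (ns ! i)),
       monoid.mult = (\<lambda>M N. \<lambda>i \<in> {..<length ns}. M i * N i),
       one = (\<lambda>i \<in> {..<length ns}. 1\<^sub>m (ns ! i)),
       zero = (\<lambda>i \<in> {..<length ns}. 0\<^sub>m (ns ! i) (ns ! i)),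
       add = (\<lambda>M N. \<lambda>i \<in> {..<length ns}. M i + N i),
       module.smult = (\<lambda>c M. \<lambda>i \<in> {..<length ns}. c \<cdot>\<^sub>m M i) \<rparr>"

text \<open>
  Finite-dimensional semi-simple algebras over an algebraically closed field are understood as
  the algebras isomorphic to $M_{n_1}(k) \times \dots \times M_{n_r}(k)$ with $r, n_i \geq 1$.
\<close>

definition fd_semisimple_algebra :: "('k :: alg_closed_field, 'a) module \<Rightarrow> bool" where
  "fd_semisimple_algebra A \<longleftrightarrow> assoc_algebra A \<and>
     (\<exists>ns. ns \<noteq> [] \<and> (\<forall>n \<in> set ns. n \<ge> 1) \<and> algebra_isomorphic A (matrix_product_algebra ns))"


section \<open>The free algebra and syntactic algebras\<close>

text \<open>
  With concatenation as the (additively written) monoid operation on words, the convolution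
  product on finitely supported functions makes \<^typ>\<open>'x list \<Rightarrow>\<^sub>0 'k\<close> the monoid
  algebra of the free monoid.
\<close>

instantiation list :: (type) monoid_add
begin

definition zero_list :: "'a list" where "zero_list = []"

definition plus_list :: "'a list \<Rightarrow> 'a list \<Rightarrow> 'a list" where "plus_list u v = u @ v"

instance by standard (simp_all add: zero_list_def plus_list_def)

end

definition free_algebra :: "'x set \<Rightarrow> ('k :: field, 'x list \<Rightarrow>\<^sub>0 'k) module" where
  "free_algebra X =
     \<lparr> carrier = {p. Poly_Mapping.keys p \<subseteq> lists X},
       monoid.mult = (*), one = 1, zero = 0, add = (+),
       module.smult = (\<lambda>c. Poly_Mapping.map ((*) c)) \<rparr>"

definition linear_extension :: "('x list \<Rightarrow> 'k :: field) \<Rightarrow> ('x list \<Rightarrow>\<^sub>0 'k) \<Rightarrow> 'k" where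
  "linear_extension S p = (\<Sum>w \<in> Poly_Mapping.keys p. Poly_Mapping.lookup p w * S w)"

text \<open>
  The greatest element with respect to inclusion; \<open>syntactic_ideal_greatest\<close> below shows that
  it exists.
\<close>

definition syntactic_ideal :: "'x set \<Rightarrow> ('x list \<Rightarrow> 'k :: field) \<Rightarrow> ('x list \<Rightarrow>\<^sub>0 'k) set" where
  "syntactic_ideal X S =
     (GREATEST I. ideal I (free_algebra X :: ('k, _) module) \<and> I \<subseteq> {p. linear_extension S p = 0})"

definition quotient_algebra :: "('k, 'a) module \<Rightarrow> 'a set \<Rightarrow> ('k, 'a set) module" where
  "quotient_algebra A I =
     ring.extend (A Quot I) \<lparr> module.smult = (\<lambda>c C. \<Union>x \<in> C. I +>\<^bsub>A\<^esub> (c \<odot>\<^bsub>A\<^esub> x)) \<rparr>"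

definition syntactic_algebra ::
    "'x set \<Rightarrow> ('x list \<Rightarrow> 'k :: field) \<Rightarrow> ('k, ('x list \<Rightarrow>\<^sub>0 'k) set) module" where
  "syntactic_algebra X S = quotient_algebra (free_algebra X) (syntactic_ideal X S)"


section \<open>Weighted monadic second order logic\<close>

subsection \<open>Syntax\<close>

text \<open>First-order and set variables form two disjoint sorts, each indexed by \<^typ>\<open>nat\<close>.\<close>

datatype var = FO nat | SO nat

datatype (constants: 'k, letters: 'x) wmso =
    Const 'k
  | Letter 'x nat
  | NotLetter 'x nat
  | Leq nat nat
  | NotLeq nat nat
  | Elem nat nat
  | NotElem nat nat
  | Disj "('k, 'x) wmso" "('k, 'x) wmso"
  | Conj "('k, 'x) wmso" "('k, 'x) wmso"
  | ExFO nat "('k, 'x) wmso"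
  | ExSO nat "('k, 'x) wmso"
  | AllFO nat "('k, 'x) wmso"
  | AllSO nat "('k, 'x) wmso"

primrec free_vars :: "('k, 'x) wmso \<Rightarrow> var set" where
  "free_vars (Const c) = {}"
| "free_vars (Letter a x) = {FO x}"
| "free_vars (NotLetter a x) = {FO x}"
| "free_vars (Leq x y) = {FO x, FO y}"
| "free_vars (NotLeq x y) = {FO x, FO y}"
| "free_vars (Elem x Z) = {FO x, SO Z}"
| "free_vars (NotElem x Z) = {FO x, SO Z}"
| "free_vars (Disj \<phi> \<psi>) = free_vars \<phi> \<union> free_vars \<psi>"
| "free_vars (Conj \<phi> \<psi>) = free_vars \<phi> \<union> free_vars \<psi>"
| "free_vars (ExFO x \<phi>) = free_vars \<phi> - {FO x}"
| "free_vars (ExSO Z \<phi>) = free_vars \<phi> - {SO Z}"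
| "free_vars (AllFO x \<phi>) = free_vars \<phi> - {FO x}"
| "free_vars (AllSO Z \<phi>) = free_vars \<phi> - {SO Z}"

subsection \<open>Semantics\<close>

text \<open>
  Positions of a word are counted from \<open>0\<close>, as list indices. An assignment consists of a
  function for the first-order variables and one for the set variables.
\<close>

primrec wmso_value ::
    "'x list \<Rightarrow> (nat \<Rightarrow> nat) \<Rightarrow> (nat \<Rightarrow> nat set) \<Rightarrow> ('k :: comm_semiring_1, 'x) wmso \<Rightarrow> 'k" where
  "wmso_value w \<sigma> \<tau> (Const c) = c"
| "wmso_value w \<sigma> \<tau> (Letter a x) = of_bool (w ! \<sigma> x = a)"
| "wmso_value w \<sigma> \<tau> (NotLetter a x) = of_bool (w ! \<sigma> x \<noteq> a)"
| "wmso_value w \<sigma> \<tau> (Leq x y) = of_bool (\<sigma> x \<le> \<sigma> y)"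
| "wmso_value w \<sigma> \<tau> (NotLeq x y) = of_bool (\<not> \<sigma> x \<le> \<sigma> y)"
| "wmso_value w \<sigma> \<tau> (Elem x Z) = of_bool (\<sigma> x \<in> \<tau> Z)"
| "wmso_value w \<sigma> \<tau> (NotElem x Z) = of_bool (\<sigma> x \<notin> \<tau> Z)"
| "wmso_value w \<sigma> \<tau> (Disj \<phi> \<psi>) = wmso_value w \<sigma> \<tau> \<phi> + wmso_value w \<sigma> \<tau> \<psi>"
| "wmso_value w \<sigma> \<tau> (Conj \<phi> \<psi>) = wmso_value w \<sigma> \<tau> \<phi> * wmso_value w \<sigma> \<tau> \<psi>"
| "wmso_value w \<sigma> \<tau> (ExFO x \<phi>) = (\<Sum>i \<in> {..<length w}. wmso_value w (\<sigma>(x := i)) \<tau> \<phi>)"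
| "wmso_value w \<sigma> \<tau> (ExSO Z \<phi>) = (\<Sum>I \<in> Pow {..<length w}. wmso_value w \<sigma> (\<tau>(Z := I)) \<phi>)"
| "wmso_value w \<sigma> \<tau> (AllFO x \<phi>) = (\<Prod>i \<in> {..<length w}. wmso_value w (\<sigma>(x := i)) \<tau> \<phi>)"
| "wmso_value w \<sigma> \<tau> (AllSO Z \<phi>) = (\<Prod>I \<in> Pow {..<length w}. wmso_value w \<sigma> (\<tau>(Z := I)) \<phi>)"

text \<open>
  A letter of the extended alphabet \<open>X \<times> {0,1}\<^sup>V\<close> is a pair \<open>(a, U)\<close> with \<open>U \<subseteq> V\<close>
  the set of variables whose characteristic function is \<open>1\<close> at that position. Such a word encodes
  an assignment if and only if every first-order variable in \<open>V\<close> occurs at exactly one position.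
\<close>

definition ext_alphabet :: "'x set \<Rightarrow> var set \<Rightarrow> ('x \<times> var set) set" where
  "ext_alphabet X V = X \<times> Pow V"

definition marked_positions :: "('x \<times> var set) list \<Rightarrow> var \<Rightarrow> nat set" where
  "marked_positions u v = {i. i < length u \<and> v \<in> snd (u ! i)}"

definition encodes_assignment :: "var set \<Rightarrow> ('x \<times> var set) list \<Rightarrow> bool" where
  "encodes_assignment V u \<longleftrightarrow> (\<forall>x. FO x \<in> V \<longrightarrow> (\<exists>!i. i \<in> marked_positions u (FO x)))"

definition wmso_series :: "('k :: comm_semiring_1, 'x) wmso \<Rightarrow> ('x \<times> var set) list \<Rightarrow> 'k" where
  "wmso_series \<phi> u =
     (if encodes_assignment (free_vars \<phi>) u
      then wmso_value (map fst u) (\<lambda>x. THE i. i \<in> marked_positions u (FO x))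
             (\<lambda>Z. marked_positions u (SO Z)) \<phi>
      else 0)"

subsection \<open>Recognisable step functions and restricted formulas\<close>

text \<open>\<open>L\<close> is accepted by a finite deterministic automaton over the alphabet \<open>\<Gamma>\<close>.\<close>

definition regular_language :: "'l set \<Rightarrow> 'l list set \<Rightarrow> bool" where
  "regular_language \<Gamma> L \<longleftrightarrow>
     (\<exists>(Q :: nat set) q\<^sub>0 \<delta> F. finite Q \<and> q\<^sub>0 \<in> Q \<and> F \<subseteq> Q \<and>
        (\<forall>a \<in> \<Gamma>. \<forall>q \<in> Q. \<delta> a q \<in> Q) \<and> L = {u \<in> lists \<Gamma>. fold \<delta> u q\<^sub>0 \<in> F})"

definition recognisable_step_function :: "'l set \<Rightarrow> ('l list \<Rightarrow> 'k :: comm_semiring_1) \<Rightarrow> bool" where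
  "recognisable_step_function \<Gamma> T \<longleftrightarrow>
     (\<exists>cLs :: ('k \<times> 'l list set) list. (\<forall>(c, L) \<in> set cLs. regular_language \<Gamma> L) \<and>
        (\<forall>u \<in> lists \<Gamma>. T u = (\<Sum>(c, L) \<leftarrow> cLs. c * indicator L u)))"

primrec restricted :: "'x set \<Rightarrow> ('k :: comm_semiring_1, 'x) wmso \<Rightarrow> bool" where
  "restricted X (Const c) \<longleftrightarrow> True"
| "restricted X (Letter a x) \<longleftrightarrow> True"
| "restricted X (NotLetter a x) \<longleftrightarrow> True"
| "restricted X (Leq x y) \<longleftrightarrow> True"
| "restricted X (NotLeq x y) \<longleftrightarrow> True"
| "restricted X (Elem x Z) \<longleftrightarrow> True"
| "restricted X (NotElem x Z) \<longleftrightarrow> True"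
| "restricted X (Disj \<phi> \<psi>) \<longleftrightarrow> restricted X \<phi> \<and> restricted X \<psi>"
| "restricted X (Conj \<phi> \<psi>) \<longleftrightarrow> restricted X \<phi> \<and> restricted X \<psi>"
| "restricted X (ExFO x \<phi>) \<longleftrightarrow> restricted X \<phi>"
| "restricted X (ExSO Z \<phi>) \<longleftrightarrow> restricted X \<phi>"
| "restricted X (AllFO x \<phi>) \<longleftrightarrow> restricted X \<phi> \<and>
     recognisable_step_function (ext_alphabet X (free_vars \<phi>)) (wmso_series \<phi>)"
| "restricted X (AllSO Z \<phi>) \<longleftrightarrow> False"

text \<open>
  The value of a closed formula does not depend on the assignment (\<open>wmso_value_cong\<close> below), so it
  may be taken at an arbitrary one.
\<close>

definition rwMSO_definable :: "'x set \<Rightarrow> ('x list \<Rightarrow> 'k :: comm_semiring_1) \<Rightarrow> bool" where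
  "rwMSO_definable X S \<longleftrightarrow>
     (\<exists>\<phi> :: ('k, 'x) wmso. letters \<phi> \<subseteq> X \<and> restricted X \<phi> \<and> free_vars \<phi> = {} \<and>
        (\<forall>w \<in> lists X. S w = wmso_value w (\<lambda>_. 0) (\<lambda>_. {}) \<phi>))"


section \<open>Well-definedness\<close>

lemma wmso_value_cong:
  assumes "\<And>x. FO x \<in> free_vars \<phi> \<Longrightarrow> \<sigma> x = \<sigma>' x"
    and "\<And>Z. SO Z \<in> free_vars \<phi> \<Longrightarrow> \<tau> Z = \<tau>' Z"
  shows "wmso_value w \<sigma> \<tau> \<phi> = wmso_value w \<sigma>' \<tau>' \<phi>"
  using assms
proof (induction \<phi> arbitrary: \<sigma> \<sigma>' \<tau> \<tau>')
  case (Disj \<phi>1 \<phi>2)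
  have "wmso_value w \<sigma> \<tau> \<phi>1 = wmso_value w \<sigma>' \<tau>' \<phi>1" by (rule Disj.IH(1)) (use Disj.prems in auto)
  moreover have "wmso_value w \<sigma> \<tau> \<phi>2 = wmso_value w \<sigma>' \<tau>' \<phi>2"
    by (rule Disj.IH(2)) (use Disj.prems in auto)
  ultimately show ?case by simp
next
  case (Conj \<phi>1 \<phi>2)
  have "wmso_value w \<sigma> \<tau> \<phi>1 = wmso_value w \<sigma>' \<tau>' \<phi>1" by (rule Conj.IH(1)) (use Conj.prems in auto)
  moreover have "wmso_value w \<sigma> \<tau> \<phi>2 = wmso_value w \<sigma>' \<tau>' \<phi>2"
    by (rule Conj.IH(2)) (use Conj.prems in auto)
  ultimately show ?case by simp
next
  case (ExFO x \<phi>)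
  show ?case unfolding wmso_value.simps
    by (intro sum.cong refl ExFO.IH) (use ExFO.prems in auto)
next
  case (ExSO x \<phi>)
  show ?case unfolding wmso_value.simps
    by (intro sum.cong refl ExSO.IH) (use ExSO.prems in auto)
next
  case (AllFO x \<phi>)
  show ?case unfolding wmso_value.simps
    by (intro prod.cong refl AllFO.IH) (use AllFO.prems in auto)
next
  case (AllSO x \<phi>)
  show ?case unfolding wmso_value.simps
    by (intro prod.cong refl AllSO.IH) (use AllSO.prems in auto)
qed auto

lemma free_algebra_simps:
  "carrier (free_algebra X) = {p. Poly_Mapping.keys p \<subseteq> lists X}"
  "monoid.mult (free_algebra X) = (*)"
  "one (free_algebra X) = 1"
  "zero (free_algebra X) = 0"
  "add (free_algebra X) = (+)"
  "module.smult (free_algebra X) c p = Poly_Mapping.single [] c * p"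
  by (simp_all add: free_algebra_def mult_map_scale_conv_mult zero_list_def)

lemma single_Nil_commute: "Poly_Mapping.single [] c * p = p * Poly_Mapping.single [] (c :: 'k :: field)"
proof (induction p rule: update_induct)
  case const
  show ?case by simp
next
  case (update f a b)
  have "Poly_Mapping.update a b f = Poly_Mapping.single a b + f"
    by (rule poly_mapping_eqI)
      (use update.hyps(1) in \<open>auto simp: lookup_update lookup_add lookup_single in_keys_iff\<close>)
  then show ?case
    using update.IH by (simp add: distrib_left distrib_right mult_single plus_list_def mult.commute)
qed

lemma assoc_algebra_free_algebra: "assoc_algebra (free_algebra X :: ('k :: field, 'x list \<Rightarrow>\<^sub>0 'k) module)"
proof -
  let ?F = "free_algebra X :: ('k, 'x list \<Rightarrow>\<^sub>0 'k) module"
  have keys: "Poly_Mapping.keys (p * q) \<subseteq> lists X"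
    if "Poly_Mapping.keys p \<subseteq> lists X" "Poly_Mapping.keys q \<subseteq> lists X"
    for p q :: "'x list \<Rightarrow>\<^sub>0 'k"
    using keys_mult[of p q] that by (fastforce simp: plus_list_def)
  have keys_single: "Poly_Mapping.keys (Poly_Mapping.single [] c) \<subseteq> lists X" for c :: 'k
    by simp
  have ab: "abelian_group ?F"
  proof (rule abelian_groupI)
    fix p assume "p \<in> carrier ?F"
    then show "\<exists>q \<in> carrier ?F. q \<oplus>\<^bsub>?F\<^esub> p = \<zero>\<^bsub>?F\<^esub>"
      by (intro bexI[of _ "- p"]) (auto simp: free_algebra_simps)
  qed (use Poly_Mapping.keys_add in \<open>fastforce simp: free_algebra_simps algebra_simps\<close>)+
  have mon: "Group.monoid ?F"
    by (rule monoidI) (auto simp: free_algebra_simps keys mult.assoc zero_list_def dest: keys[THEN subsetD, rotated 2])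
  have ring: "ring ?F"
    by (rule ringI[OF ab mon]) (auto simp: free_algebra_simps algebra_simps)
  have mod: "Module.module class_ring ?F"
  proof (rule moduleI[OF class_cring.is_cring ab])
    fix c p assume "p \<in> carrier ?F"
    then show "c \<odot>\<^bsub>?F\<^esub> p \<in> carrier ?F"
      using keys[OF keys_single] by (auto simp: free_algebra_simps)
  qed (auto simp: free_algebra_simps algebra_simps single_add mult_single
        simp flip: mult.assoc zero_list_def)
  show ?thesis
  proof (intro assoc_algebra.intro assoc_algebra_axioms.intro ring mod)
    fix x y c
    show "(c \<odot>\<^bsub>?F\<^esub> x) \<otimes>\<^bsub>?F\<^esub> y = c \<odot>\<^bsub>?F\<^esub> (x \<otimes>\<^bsub>?F\<^esub> y)"
      by (simp add: free_algebra_simps mult.assoc)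
    show "x \<otimes>\<^bsub>?F\<^esub> (c \<odot>\<^bsub>?F\<^esub> y) = c \<odot>\<^bsub>?F\<^esub> (x \<otimes>\<^bsub>?F\<^esub> y)"
      by (simp add: free_algebra_simps single_Nil_commute mult.assoc)
  qed
qed

lemma linear_extension_superset:
  assumes "finite W" "Poly_Mapping.keys p \<subseteq> W"
  shows "linear_extension S p = (\<Sum>w \<in> W. Poly_Mapping.lookup p w * S w)"
  unfolding linear_extension_def
  by (rule sum.mono_neutral_left) (use assms in \<open>auto simp: in_keys_iff\<close>)

lemma linear_extension_add: "linear_extension S (p + q) = linear_extension S p + linear_extension S q"
proof -
  let ?W = "Poly_Mapping.keys p \<union> Poly_Mapping.keys q"
  have "Poly_Mapping.keys (p + q) \<subseteq> ?W" by (rule Poly_Mapping.keys_add)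
  then show ?thesis
    by (simp add: linear_extension_superset[of ?W] lookup_add algebra_simps sum.distrib)
qed

lemma linear_extension_zero [simp]: "linear_extension S 0 = 0"
  by (simp add: linear_extension_def)

lemma linear_extension_uminus: "linear_extension S (- p) = - linear_extension S p"
  using linear_extension_add[of S p "- p"] by (simp add: add_eq_0_iff)

lemma syntactic_ideal_greatest:
  fixes X :: "'x set" and S :: "'x list \<Rightarrow> 'k :: field"
  defines "F \<equiv> (free_algebra X :: ('k, 'x list \<Rightarrow>\<^sub>0 'k) module)"
  shows "ideal (syntactic_ideal X S) F"
    and "syntactic_ideal X S \<subseteq> {p. linear_extension S p = 0}"
    and "ideal J F \<Longrightarrow> J \<subseteq> {p. linear_extension S p = 0} \<Longrightarrow> J \<subseteq> syntactic_ideal X S"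
    and "syntactic_ideal X S =
      {p \<in> carrier F. \<forall>q \<in> carrier F. \<forall>r \<in> carrier F. linear_extension S (q * p * r) = 0}"
proof -
  define I where
    "I = {p \<in> carrier F. \<forall>q \<in> carrier F. \<forall>r \<in> carrier F. linear_extension S (q * p * r) = 0}"
  interpret F: assoc_algebra F unfolding F_def by (rule assoc_algebra_free_algebra)
  have mult_F: "monoid.mult F = (*)" and add_F: "add F = (+)" and zero_F: "zero F = 0" and one_F: "one F = 1"
    by (simp_all add: F_def free_algebra_simps)
  have cl: "p * q \<in> carrier F" "p + q \<in> carrier F" if "p \<in> carrier F" "q \<in> carrier F" for p q
    using F.m_closed[of p q] F.add.m_closed[of p q] that by (simp_all add: mult_F add_F)
  have cl1: "0 \<in> carrier F" "1 \<in> carrier F"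
    using F.zero_closed F.one_closed by (simp_all add: zero_F one_F)
  have minus_F: "a_inv F p = - p" "- p \<in> carrier F" if "p \<in> carrier F" for p
  proof -
    show *: "- p \<in> carrier F" using that by (simp add: F_def free_algebra_simps)
    show "a_inv F p = - p" by (rule F.minus_equality) (use that * in \<open>auto simp: add_F zero_F\<close>)
  qed
  have ideal_I: "ideal I F"
  proof (rule idealI[OF F.ring_axioms])
    show "subgroup I (add_monoid F)"
    proof (rule subgroup.intro)
      fix p assume p: "p \<in> I"
      then have "inv\<^bsub>add_monoid F\<^esub> p = - p"
        using minus_F(1)[of p] by (auto simp: I_def a_inv_def)
      then show "inv\<^bsub>add_monoid F\<^esub> p \<in> I"
        using p minus_F(2) by (auto simp: I_def linear_extension_uminus)
    qed (auto simp: I_def cl cl1 add_F zero_F algebra_simps linear_extension_add)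
  next
    fix a x assume a: "a \<in> I" and x: "x \<in> carrier F"
    show "x \<otimes>\<^bsub>F\<^esub> a \<in> I"
    proof -
      have "linear_extension S (q * (x * a) * r) = 0" if "q \<in> carrier F" "r \<in> carrier F" for q r
      proof -
        have "linear_extension S ((q * x) * a * r) = 0" using a x that cl by (auto simp: I_def)
        then show ?thesis by (simp add: mult.assoc)
      qed
      then show ?thesis using a x cl by (auto simp: I_def mult_F)
    qed
    show "a \<otimes>\<^bsub>F\<^esub> x \<in> I"
    proof -
      have "linear_extension S (q * (a * x) * r) = 0" if "q \<in> carrier F" "r \<in> carrier F" for q r
      proof -
        have "linear_extension S (q * a * (x * r)) = 0" using a x that cl by (auto simp: I_def)
        then show ?thesis by (simp add: mult.assoc)
      qed
      then show ?thesis using a x cl by (auto simp: I_def mult_F)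
    qed
  qed
  have ker_I: "I \<subseteq> {p. linear_extension S p = 0}"
  proof
    fix p assume "p \<in> I"
    then have "linear_extension S (1 * p * 1) = 0" using cl1 unfolding I_def by blast
    then show "p \<in> {p. linear_extension S p = 0}" by simp
  qed
  have greatest_I: "J \<subseteq> I" if J: "ideal J F" "J \<subseteq> {p. linear_extension S p = 0}" for J
  proof
    interpret J: ideal J F by (rule J(1))
    fix p assume p: "p \<in> J"
    have "q * p * r \<in> J" if "q \<in> carrier F" "r \<in> carrier F" for q r
      using J.I_r_closed[OF J.I_l_closed[OF p that(1)] that(2)] by (simp add: mult_F)
    then show "p \<in> I" using J(2) p J.a_subset by (auto simp: I_def)
  qed
  have "syntactic_ideal X S = I"
    unfolding syntactic_ideal_def F_def[symmetric]
    by (rule Greatest_equality) (use ideal_I ker_I greatest_I in auto)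
  then show "ideal (syntactic_ideal X S) F" "syntactic_ideal X S \<subseteq> {p. linear_extension S p = 0}"
    "ideal J F \<Longrightarrow> J \<subseteq> {p. linear_extension S p = 0} \<Longrightarrow> J \<subseteq> syntactic_ideal X S"
    "syntactic_ideal X S =
      {p \<in> carrier F. \<forall>q \<in> carrier F. \<forall>r \<in> carrier F. linear_extension S (q * p * r) = 0}"
    using ideal_I ker_I greatest_I unfolding I_def by auto
qed

lemma quotient_algebra_simps:
  "carrier (quotient_algebra A I) = a_rcosets\<^bsub>A\<^esub> I"
  "monoid.mult (quotient_algebra A I) = rcoset_mult A I"
  "one (quotient_algebra A I) = I +>\<^bsub>A\<^esub> \<one>\<^bsub>A\<^esub>"
  "zero (quotient_algebra A I) = I"
  "add (quotient_algebra A I) = set_add A"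
  "module.smult (quotient_algebra A I) c C = (\<Union>x \<in> C. I +>\<^bsub>A\<^esub> (c \<odot>\<^bsub>A\<^esub> x))"
  by (simp_all add: quotient_algebra_def FactRing_def ring.defs)

lemma quotient_algebra_smult_coset:
  assumes "assoc_algebra A" "ideal I A" "x \<in> carrier A"
  shows "c \<odot>\<^bsub>quotient_algebra A I\<^esub> (I +>\<^bsub>A\<^esub> x) = I +>\<^bsub>A\<^esub> (c \<odot>\<^bsub>A\<^esub> x)"
proof -
  interpret A: assoc_algebra A by fact
  interpret I: ideal I A by fact
  have sc: "c \<odot>\<^bsub>A\<^esub> y \<in> carrier A" if "y \<in> carrier A" for y
    by (rule A.scalars.smult_closed) (use that in auto)
  have "I +>\<^bsub>A\<^esub> (c \<odot>\<^bsub>A\<^esub> y) = I +>\<^bsub>A\<^esub> (c \<odot>\<^bsub>A\<^esub> x)" if y: "y \<in> I +>\<^bsub>A\<^esub> x" for y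
  proof -
    obtain i where i: "i \<in> I" "y = i \<oplus>\<^bsub>A\<^esub> x"
      using y by (auto simp: a_r_coset_def')
    have iA: "i \<in> carrier A" using i I.a_subset by auto
    have "c \<odot>\<^bsub>A\<^esub> i = (c \<odot>\<^bsub>A\<^esub> \<one>\<^bsub>A\<^esub>) \<otimes>\<^bsub>A\<^esub> i"
      using A.smult_mult_left[of "\<one>\<^bsub>A\<^esub>" i c] iA by simp
    then have "c \<odot>\<^bsub>A\<^esub> i \<in> I" using I.I_l_closed[OF i(1)] sc by simp
    moreover have "c \<odot>\<^bsub>A\<^esub> y = c \<odot>\<^bsub>A\<^esub> i \<oplus>\<^bsub>A\<^esub> c \<odot>\<^bsub>A\<^esub> x"
      unfolding i(2) by (rule A.scalars.smult_r_distr) (use iA assms in auto)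
    ultimately have "c \<odot>\<^bsub>A\<^esub> y \<in> I +>\<^bsub>A\<^esub> (c \<odot>\<^bsub>A\<^esub> x)" by (auto simp: a_r_coset_def')
    then show ?thesis using I.a_repr_independence' sc assms(3) by metis
  qed
  moreover have "x \<in> I +>\<^bsub>A\<^esub> x" by (rule I.a_rcos_self) fact
  ultimately show ?thesis unfolding quotient_algebra_simps by blast
qed

lemma assoc_algebra_quotient_algebra:
  assumes "assoc_algebra A" "ideal I A"
  shows "assoc_algebra (quotient_algebra A I)"
proof -
  interpret A: assoc_algebra A by fact
  interpret I: ideal I A by fact
  let ?Q = "quotient_algebra A I"
  have ring: "ring ?Q"
  proof -
    interpret R: ring "A Quot I" by (rule I.quotient_is_ring)
    note simps = quotient_algebra_simps FactRing_def
    show ?thesis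
    proof (intro ringI abelian_groupI monoidI)
      fix x assume "x \<in> carrier ?Q"
      then show "\<exists>y \<in> carrier ?Q. y \<oplus>\<^bsub>?Q\<^esub> x = \<zero>\<^bsub>?Q\<^esub>"
        using R.l_neg[of x] R.a_inv_closed[of x] by (auto simp: simps)
    qed (use R.add.m_closed R.zero_closed R.one_closed R.m_closed R.add.m_assoc R.add.m_comm R.l_zero
          R.l_one R.r_one R.m_assoc R.l_distr R.r_distr in \<open>simp_all add: simps\<close>)
  qed
  have sc: "c \<odot>\<^bsub>A\<^esub> x \<in> carrier A" if "x \<in> carrier A" for c x
    by (rule A.scalars.smult_closed) (use that in auto)
  have carrier: "\<exists>a \<in> carrier A. x = I +>\<^bsub>A\<^esub> a" if "x \<in> carrier ?Q" for x
    using that by (auto simp: quotient_algebra_simps A_RCOSETS_def')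
  have coset: "I +>\<^bsub>A\<^esub> a \<in> carrier ?Q" if "a \<in> carrier A" for a
    using that by (auto simp: quotient_algebra_simps A_RCOSETS_def')
  have add: "(I +>\<^bsub>A\<^esub> a) \<oplus>\<^bsub>?Q\<^esub> (I +>\<^bsub>A\<^esub> b) = I +>\<^bsub>A\<^esub> (a \<oplus>\<^bsub>A\<^esub> b)"
    if "a \<in> carrier A" "b \<in> carrier A" for a b
    using that by (simp add: quotient_algebra_simps I.a_rcos_sum)
  have mult: "(I +>\<^bsub>A\<^esub> a) \<otimes>\<^bsub>?Q\<^esub> (I +>\<^bsub>A\<^esub> b) = I +>\<^bsub>A\<^esub> (a \<otimes>\<^bsub>A\<^esub> b)"
    if "a \<in> carrier A" "b \<in> carrier A" for a b
    using that by (simp add: quotient_algebra_simps I.rcoset_mult_add)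
  note smult = quotient_algebra_smult_coset[OF assms]
  show ?thesis
  proof (intro assoc_algebra.intro assoc_algebra_axioms.intro ring moduleI class_cring.is_cring
      ring.is_abelian_group)
    fix c x assume "x \<in> carrier ?Q"
    then show "c \<odot>\<^bsub>?Q\<^esub> x \<in> carrier ?Q" by (auto dest!: carrier simp: smult sc coset)
  next
    fix c d x assume "x \<in> carrier ?Q"
    then show "(c \<oplus>\<^bsub>class_ring\<^esub> d) \<odot>\<^bsub>?Q\<^esub> x = c \<odot>\<^bsub>?Q\<^esub> x \<oplus>\<^bsub>?Q\<^esub> d \<odot>\<^bsub>?Q\<^esub> x"
      using A.scalars.smult_l_distr[of c d] by (auto dest!: carrier simp: smult sc add)
  next
    fix c x y assume "x \<in> carrier ?Q" "y \<in> carrier ?Q"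
    then show "c \<odot>\<^bsub>?Q\<^esub> (x \<oplus>\<^bsub>?Q\<^esub> y) = c \<odot>\<^bsub>?Q\<^esub> x \<oplus>\<^bsub>?Q\<^esub> c \<odot>\<^bsub>?Q\<^esub> y"
      using A.scalars.smult_r_distr[of c] by (auto dest!: carrier simp: smult sc add)
  next
    fix c d x assume "x \<in> carrier ?Q"
    then show "(c \<otimes>\<^bsub>class_ring\<^esub> d) \<odot>\<^bsub>?Q\<^esub> x = c \<odot>\<^bsub>?Q\<^esub> (d \<odot>\<^bsub>?Q\<^esub> x)"
      using A.scalars.smult_assoc1[of c d] by (auto dest!: carrier simp: smult sc)
  next
    fix x assume "x \<in> carrier ?Q"
    then show "\<one>\<^bsub>class_ring\<^esub> \<odot>\<^bsub>?Q\<^esub> x = x"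
      using A.scalars.smult_one by (auto dest!: carrier simp: smult)
  next
    fix x y c assume "x \<in> carrier ?Q" "y \<in> carrier ?Q"
    then show "(c \<odot>\<^bsub>?Q\<^esub> x) \<otimes>\<^bsub>?Q\<^esub> y = c \<odot>\<^bsub>?Q\<^esub> (x \<otimes>\<^bsub>?Q\<^esub> y)"
      and "x \<otimes>\<^bsub>?Q\<^esub> (c \<odot>\<^bsub>?Q\<^esub> y) = c \<odot>\<^bsub>?Q\<^esub> (x \<otimes>\<^bsub>?Q\<^esub> y)"
      by (auto dest!: carrier simp: smult sc mult A.smult_mult_left A.smult_mult_right)
  qed
qed

corollary assoc_algebra_syntactic_algebra: "assoc_algebra (syntactic_algebra X S)"
  unfolding syntactic_algebra_def
  by (intro assoc_algebra_quotient_algebra assoc_algebra_free_algebra syntactic_ideal_greatest(1))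

end

(*
  Only the finite dimension of the syntactic algebra matters. Coordinate functionals on it pull back to
  linear functionals on the free algebra whose common kernel is the syntactic ideal. Since that ideal
  is two-sided, appending a letter acts linearly on the coordinates of a word, so S is computed by a
  finite weighted automaton, and S w is a sum over runs of products of transition weights. A run is
  guessed by set quantifiers (the q-th set holds the positions reached in state q), and its weight is
  the value of a formula "for all x", whose matrix looks at the letter and state at x and at the state
  of the predecessor of x. As that formula takes finitely many values, all determined by a finite
  automaton, the whole formula is restricted.
*)

theory Submission
  imports Defs
begin

lemma recognisable_step_function_if_finite_state:
  fixes h :: "'l list \<Rightarrow> 'b"
  assumes fin: "finite (h ` lists \<Gamma>)"
    and step: "\<And>a u. a \<in> \<Gamma> \<Longrightarrow> u \<in> lists \<Gamma> \<Longrightarrow> h (u @ [a]) = \<delta> a (h u)"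
    and out: "\<And>u. u \<in> lists \<Gamma> \<Longrightarrow> T u = g (h u)"
  shows "recognisable_step_function \<Gamma> T"
proof -
  let ?H = "h ` lists \<Gamma>"
  obtain e :: "'b \<Rightarrow> nat" where inj: "inj_on e ?H"
    using finite_imp_inj_to_nat_seg[OF fin] by blast
  define Q where "Q = e ` ?H"
  define d where "d = inv_into ?H e"
  have de: "d (e (h u)) = h u" if "u \<in> lists \<Gamma>" for u
    unfolding d_def by (rule inv_into_f_f[OF inj]) (use that in auto)
  have finQ: "finite Q" using fin by (simp add: Q_def)
  define \<delta>' where "\<delta>' = (\<lambda>a s. e (\<delta> a (d s)))"
  have run: "fold \<delta>' u (e (h [])) = e (h u)" if "u \<in> lists \<Gamma>" for u
    using that by (induction u rule: rev_induct) (auto simp: \<delta>'_def de step)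
  have step': "\<delta>' a q \<in> Q" if "a \<in> \<Gamma>" "q \<in> Q" for a q
  proof -
    obtain u where u: "u \<in> lists \<Gamma>" "q = e (h u)" using \<open>q \<in> Q\<close> by (auto simp: Q_def)
    then have "\<delta>' a q = e (h (u @ [a]))" using \<open>a \<in> \<Gamma>\<close> by (simp add: \<delta>'_def de step)
    then show ?thesis using u \<open>a \<in> \<Gamma>\<close> by (auto simp: Q_def)
  qed
  define L where "L = (\<lambda>s. {u \<in> lists \<Gamma>. e (h u) = s})"
  have reg: "regular_language \<Gamma> (L s)" if "s \<in> Q" for s
    unfolding regular_language_def
  proof (intro exI conjI)
    show "L s = {u \<in> lists \<Gamma>. fold \<delta>' u (e (h [])) \<in> {s}}"
      by (auto simp: L_def run[OF in_listsI])
    show "e (h []) \<in> Q" by (auto simp: Q_def)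
  qed (use finQ that step' in auto)
  define cLs where "cLs = map (\<lambda>s. (g (d s), L s)) (sorted_list_of_set Q)"
  show ?thesis unfolding recognisable_step_function_def
  proof (intro exI[of _ cLs] conjI ballI)
    fix p assume "p \<in> set cLs"
    then show "case p of (c, l) \<Rightarrow> regular_language \<Gamma> l"
      using finQ reg by (auto simp: cLs_def)
  next
    fix u assume u: "u \<in> lists \<Gamma>"
    have "(\<Sum>(c, l) \<leftarrow> cLs. c * indicator l u) = (\<Sum>s \<in> Q. g (d s) * indicator (L s) u)"
      using finQ by (simp add: cLs_def comp_def sum_list_distinct_conv_sum_set)
    also have "\<dots> = (\<Sum>s \<in> Q. if s = e (h u) then g (d s) else 0)"
      using u by (intro sum.cong) (auto simp: L_def)
    also have "\<dots> = T u"
      using u finQ by (auto simp: sum.delta Q_def de out)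
    finally show "T u = (\<Sum>(c, l) \<leftarrow> cLs. c * indicator l u)" by simp
  qed
qed

lemma finite_ext_alphabet: "finite X \<Longrightarrow> finite V \<Longrightarrow> finite (ext_alphabet X V)"
  by (simp add: ext_alphabet_def)

lemma marked_positions_snoc:
  "marked_positions (u @ [a]) v = marked_positions u v \<union> (if v \<in> snd a then {length u} else {})"
  by (auto simp: marked_positions_def nth_append less_Suc_eq)

lemma finite_marked_positions [simp]: "finite (marked_positions u v)"
  by (simp add: marked_positions_def)

lemma card_marked_positions_snoc:
  "card (marked_positions (u @ [a]) v) = card (marked_positions u v) + of_bool (v \<in> snd a)"
proof -
  have "length u \<notin> marked_positions u v" by (simp add: marked_positions_def)
  then show ?thesis by (simp add: marked_positions_snoc)
qed

lemma ex1_marked_positions_iff: "(\<exists>!i. i \<in> marked_positions u v) \<longleftrightarrow> card (marked_positions u v) = 1"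
  by (auto simp: card_1_singleton_iff)

text \<open>
  For variable 1 before variable 0, no position lies strictly between the two if and only if this
  formula has value \<open>1\<close> for every value of variable 2. (At most one disjunct holds, so the sum
  behaves as a disjunction.)
\<close>

definition between_formula :: "('k, 'x) wmso" where
  "between_formula = Disj (Leq 2 1) (Leq 0 2)"

lemma recognisable_step_function_between_formula:
  fixes X :: "'x set"
  assumes "finite X"
  shows "recognisable_step_function (ext_alphabet X (free_vars (between_formula :: ('k :: comm_semiring_1, 'x) wmso)))
    (wmso_series (between_formula :: ('k, 'x) wmso))"
proof -
  define V where "V = {FO 0, FO 1, FO 2}"
  have V: "free_vars (between_formula :: ('k, 'x) wmso) = V"
    by (auto simp: between_formula_def V_def)
  define c where "c = (\<lambda>u :: ('x \<times> var set) list. \<lambda>v \<in> V. min 2 (card (marked_positions u v)))"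
  define R where "R = (\<lambda>u :: ('x \<times> var set) list.
    {(v, v') \<in> V \<times> V. \<exists>i \<in> marked_positions u v. \<exists>j \<in> marked_positions u v'. i \<le> j})"
  have less: "i < length u" if "i \<in> marked_positions u v" for i v and u :: "('x \<times> var set) list"
    using that by (simp add: marked_positions_def)
  have c0: "c u v = 0 \<longleftrightarrow> marked_positions u v = {}" if "v \<in> V" for u v
    using that by (auto simp: c_def min_def)
  show ?thesis unfolding V
  proof (rule recognisable_step_function_if_finite_state)
    let ?h = "\<lambda>u. (c u, R u)"
    show "finite (?h ` lists (ext_alphabet X V))"
    proof (rule finite_subset)
      show "?h ` lists (ext_alphabet X V) \<subseteq> (V \<rightarrow>\<^sub>E {..2}) \<times> Pow (V \<times> V)"
        by (auto simp: c_def R_def)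
      show "finite ((V \<rightarrow>\<^sub>E {..2 :: nat}) \<times> Pow (V \<times> V))"
        by (intro finite_cartesian_product finite_PiE) (auto simp: V_def)
    qed
    fix a u
    let ?\<delta> = "\<lambda>a (c, R). (\<lambda>v \<in> V. min (2 :: nat) (c v + of_bool (v \<in> snd a)),
      R \<union> {(v, v') \<in> V \<times> V. v' \<in> snd a \<and> (c v \<noteq> 0 \<or> v \<in> snd a)})"
    have "c (u @ [a]) = (\<lambda>v \<in> V. min 2 (c u v + of_bool (v \<in> snd a)))"
      by (rule ext) (simp add: c_def card_marked_positions_snoc min_def)
    moreover have "R (u @ [a]) = R u \<union> {(v, v') \<in> V \<times> V. v' \<in> snd a \<and> (c u v \<noteq> 0 \<or> v \<in> snd a)}"
      (is "_ = R u \<union> ?N")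
    proof -
      have "(v, v') \<in> R (u @ [a]) \<longleftrightarrow> (v, v') \<in> R u \<union> ?N" if v: "v \<in> V" "v' \<in> V" for v v'
        using v less[of _ u v] less[of _ u v'] c0[OF v(1), of u]
        by (auto simp: R_def marked_positions_snoc intro: less_imp_le) (meson leD)+
      moreover have "R (u @ [a]) \<subseteq> V \<times> V" "R u \<union> ?N \<subseteq> V \<times> V"
        by (auto simp: R_def)
      moreover have ext: "A = B" if "A \<subseteq> V \<times> V" "B \<subseteq> V \<times> V"
        "\<And>v v'. v \<in> V \<Longrightarrow> v' \<in> V \<Longrightarrow> (v, v') \<in> A \<longleftrightarrow> (v, v') \<in> B" for A B
        using that by auto
      ultimately show ?thesis by (intro ext)
    qed
    ultimately show "?h (u @ [a]) = ?\<delta> a (?h u)" by simp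
  next
    fix u :: "('x \<times> var set) list"
    let ?g = "\<lambda>(c, R). if \<forall>v \<in> V. c v = (1 :: nat) then of_bool ((FO 2, FO 1) \<in> R) + of_bool ((FO 0, FO 2) \<in> R) else 0"
    have c1: "c u v = 1 \<longleftrightarrow> card (marked_positions u v) = 1" if "v \<in> V" for v
      using that by (auto simp: c_def min_def)
    have enc: "encodes_assignment V u \<longleftrightarrow> (\<forall>v \<in> V. c u v = 1)"
      using c1 by (auto simp: encodes_assignment_def ex1_marked_positions_iff V_def)
    show "wmso_series (between_formula :: ('k, 'x) wmso) u = ?g (c u, R u)"
    proof (cases "encodes_assignment V u")
      case True
      have "\<exists>i. marked_positions u v = {i}" if "v \<in> V" for v
        using True that enc c1 by (auto simp: card_1_singleton_iff)
      then obtain i where i: "marked_positions u v = {i v}" if "v \<in> V" for v by metis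
      have the: "(THE j. j \<in> marked_positions u v) = i v" if "v \<in> V" for v
        using i[OF that] by simp
      have R: "(v, v') \<in> R u \<longleftrightarrow> i v \<le> i v'" if "v \<in> V" "v' \<in> V" for v v'
        using that by (auto simp: R_def i)
      have mem: "FO 0 \<in> V" "FO 1 \<in> V" "FO 2 \<in> V" by (simp_all add: V_def)
      have "wmso_series (between_formula :: ('k, 'x) wmso) u =
          wmso_value (map fst u) (\<lambda>x. THE i. i \<in> marked_positions u (FO x))
            (\<lambda>Z. marked_positions u (SO Z)) between_formula"
        using True by (simp only: wmso_series_def V if_True)
      also have "\<dots> = of_bool (i (FO 2) \<le> i (FO 1)) + of_bool (i (FO 0) \<le> i (FO 2))"
        by (simp only: between_formula_def wmso_value.simps the mem)
      also have "\<dots> = of_bool ((FO 2, FO 1) \<in> R u) + of_bool ((FO 0, FO 2) \<in> R u)"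
        by (simp only: R mem)
      also have "\<dots> = ?g (c u, R u)"
        unfolding prod.case by (rule if_P[symmetric]) (use True enc in blast)
      finally show ?thesis .
    qed (use enc in \<open>auto simp: wmso_series_def V\<close>)
  qed
qed


lemma recognisable_step_function_of_marked_position:
  fixes \<Gamma> :: "'l set" and G :: "'l \<Rightarrow> 'l option \<Rightarrow> 'k :: comm_semiring_1"
  assumes "finite \<Gamma>"
    and T: "\<And>u i. u \<in> lists \<Gamma> \<Longrightarrow> {j. j < length u \<and> P (u ! j)} = {i} \<Longrightarrow>
      T u = G (u ! i) (if i = 0 then None else Some (u ! (i - 1)))"
    and T0: "\<And>u. u \<in> lists \<Gamma> \<Longrightarrow> card {j. j < length u \<and> P (u ! j)} \<noteq> 1 \<Longrightarrow> T u = 0"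
  shows "recognisable_step_function \<Gamma> T"
proof (rule recognisable_step_function_if_finite_state)
  define m where "m = (\<lambda>u :: 'l list. {j. j < length u \<and> P (u ! j)})"
  define l where "l = (\<lambda>u :: 'l list. if u = [] then None else Some (last u))"
  let ?h = "\<lambda>u. (min 2 (card (m u)), T u, l u)"
  have m_snoc: "m (u @ [a]) = m u \<union> (if P a then {length u} else {})" for u a
    by (auto simp: m_def nth_append less_Suc_eq)
  have T: "T u = G (u ! i) (if i = 0 then None else Some (u ! (i - 1)))" if "u \<in> lists \<Gamma>" "m u = {i}" for u i
    using that unfolding m_def by (rule T)
  have T0: "T u = 0" if "u \<in> lists \<Gamma>" "card (m u) \<noteq> 1" for u
    using that unfolding m_def by (rule T0)
  have fin: "finite (m u)" for u by (simp add: m_def)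
  have card_snoc: "card (m (u @ [a])) = card (m u) + of_bool (P a)" for u a
  proof -
    have "length u \<notin> m u" by (simp add: m_def)
    then show ?thesis by (simp add: m_snoc fin)
  qed
  have l_in: "l u \<in> insert None (Some ` \<Gamma>)" if "u \<in> lists \<Gamma>" for u
    using that by (auto simp: l_def)
  have T_in: "T u \<in> insert 0 (case_prod G ` (\<Gamma> \<times> insert None (Some ` \<Gamma>)))" if u: "u \<in> lists \<Gamma>" for u
  proof (cases "card (m u) = 1")
    case True
    then obtain i where i: "m u = {i}" by (auto simp: card_1_singleton_iff)
    then have "i < length u" by (auto simp: m_def)
    then have "u ! i \<in> \<Gamma>" "u ! (i - 1) \<in> \<Gamma>" using u by (auto simp: in_lists_conv_set)
    then show ?thesis using T[OF u i] by force
  next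
    case False
    then show ?thesis using T0[OF u] by simp
  qed
  show "finite (?h ` lists \<Gamma>)"
  proof (rule finite_subset)
    show "?h ` lists \<Gamma> \<subseteq> {..2} \<times> insert 0 (case_prod G ` (\<Gamma> \<times> insert None (Some ` \<Gamma>))) \<times> insert None (Some ` \<Gamma>)"
      by (intro image_subsetI SigmaI T_in l_in) simp_all
  qed (use \<open>finite \<Gamma>\<close> in simp)
  let ?\<delta> = "\<lambda>a (c, t, l). (min 2 (c + of_bool (P a)), if P a then if c = (0 :: nat) then G a l else 0 else t, Some a)"
  show "?h (u @ [a]) = ?\<delta> a (?h u)" if "a \<in> \<Gamma>" "u \<in> lists \<Gamma>" for a u
  proof -
    have ua: "u @ [a] \<in> lists \<Gamma>" using that by simp
    have "T (u @ [a]) = (if P a then if card (m u) = 0 then G a (l u) else 0 else T u)"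
    proof (cases "P a")
      case True
      show ?thesis
      proof (cases "card (m u) = 0")
        case True
        then have "m (u @ [a]) = {length u}" using \<open>P a\<close> fin[of u] by (simp add: m_snoc)
        from T[OF ua this] show ?thesis using \<open>P a\<close> True
          by (auto simp: l_def nth_append last_conv_nth)
      next
        case False
        then have "card (m (u @ [a])) \<noteq> 1" using \<open>P a\<close> by (simp add: card_snoc)
        then show ?thesis using T0[OF ua] \<open>P a\<close> False by simp
      qed
    next
      case False
      then have m: "m (u @ [a]) = m u" by (simp add: m_snoc)
      show ?thesis
      proof (cases "card (m u) = 1")
        case True
        then obtain i where i: "m u = {i}" by (auto simp: card_1_singleton_iff)
        then have "i < length u" by (auto simp: m_def)
        then show ?thesis
          using T[OF ua, of i] T[OF that(2), of i] i m False
          by (auto simp: nth_append)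
      next
        case False
        then show ?thesis using T0[OF ua] T0[OF that(2)] m \<open>\<not> P a\<close> by simp
      qed
    qed
    then show ?thesis by (simp add: card_snoc l_def min_def)
  qed
  show "T u = (case ?h u of (c, t, l) \<Rightarrow> t)" if "u \<in> lists \<Gamma>" for u by simp
qed

definition sum_formula :: "('i \<Rightarrow> ('k :: comm_semiring_1, 'x) wmso) \<Rightarrow> 'i list \<Rightarrow> ('k, 'x) wmso" where
  "sum_formula \<phi> is = foldr (\<lambda>i. Disj (\<phi> i)) is (Const 0)"

definition prod_formula :: "('i \<Rightarrow> ('k :: comm_semiring_1, 'x) wmso) \<Rightarrow> 'i list \<Rightarrow> ('k, 'x) wmso" where
  "prod_formula \<phi> is = foldr (\<lambda>i. Conj (\<phi> i)) is (Const 1)"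

lemma sum_formula_simps [simp]:
  "wmso_value w \<sigma> \<tau> (sum_formula \<phi> is) = (\<Sum>i \<leftarrow> is. wmso_value w \<sigma> \<tau> (\<phi> i))"
  "free_vars (sum_formula \<phi> is) = (\<Union>i \<in> set is. free_vars (\<phi> i))"
  "letters (sum_formula \<phi> is) = (\<Union>i \<in> set is. letters (\<phi> i))"
  "restricted X (sum_formula \<phi> is) \<longleftrightarrow> (\<forall>i \<in> set is. restricted X (\<phi> i))"
  by (induction "is") (simp_all add: sum_formula_def)

lemma prod_formula_simps [simp]:
  "wmso_value w \<sigma> \<tau> (prod_formula \<phi> is) = (\<Prod>i \<leftarrow> is. wmso_value w \<sigma> \<tau> (\<phi> i))"
  "free_vars (prod_formula \<phi> is) = (\<Union>i \<in> set is. free_vars (\<phi> i))"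
  "letters (prod_formula \<phi> is) = (\<Union>i \<in> set is. letters (\<phi> i))"
  "restricted X (prod_formula \<phi> is) \<longleftrightarrow> (\<forall>i \<in> set is. restricted X (\<phi> i))"
  by (induction "is") (simp_all add: prod_formula_def)

definition predecessor_formula :: "nat \<Rightarrow> ('k, 'x) wmso" where
  "predecessor_formula p = ExFO 1 (Conj (Elem 1 p) (Conj (NotLeq 0 1) (AllFO 2 between_formula)))"

lemma prod_of_bool: "finite A \<Longrightarrow> (\<Prod>i \<in> A. of_bool (P i) :: 'k :: comm_semiring_1) = of_bool (\<forall>i \<in> A. P i)"
  by (induction A rule: finite_induct) auto

lemma prod_list_of_bool: "(\<Prod>i \<leftarrow> is. of_bool (P i) :: 'k :: comm_semiring_1) = of_bool (\<forall>i \<in> set is. P i)"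
  by (induction "is") auto

lemma wmso_value_predecessor_formula:
  assumes "\<sigma> 0 < length w"
  shows "wmso_value w \<sigma> \<tau> (predecessor_formula p :: ('k :: comm_semiring_1, 'x) wmso) =
    of_bool (\<sigma> 0 \<noteq> 0 \<and> \<sigma> 0 - 1 \<in> \<tau> p)"
proof -
  have eq: "of_bool (j \<in> \<tau> p) * (of_bool (\<not> \<sigma> 0 \<le> j) *
      (\<Prod>l \<in> {..<length w}. of_bool (l \<le> j) + of_bool (\<sigma> 0 \<le> l))) =
    (if j = \<sigma> 0 - 1 then of_bool (\<sigma> 0 \<noteq> 0 \<and> j \<in> \<tau> p) else 0 :: 'k)" for j
  proof (cases "j < \<sigma> 0")
    case True
    have "(\<Prod>l \<in> {..<length w}. of_bool (l \<le> j) + of_bool (\<sigma> 0 \<le> l) :: 'k) =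
      (\<Prod>l \<in> {..<length w}. of_bool (l \<le> j \<or> \<sigma> 0 \<le> l))"
      using True by (intro prod.cong) auto
    also have "\<dots> = of_bool (\<forall>l \<in> {..<length w}. l \<le> j \<or> \<sigma> 0 \<le> l)"
      by (rule prod_of_bool) simp
    also have "(\<forall>l \<in> {..<length w}. l \<le> j \<or> \<sigma> 0 \<le> l) \<longleftrightarrow> j = \<sigma> 0 - 1"
    proof
      assume *: "\<forall>l \<in> {..<length w}. l \<le> j \<or> \<sigma> 0 \<le> l"
      have "Suc j < length w" using True assms by simp
      then show "j = \<sigma> 0 - 1" using *[rule_format, of "Suc j"] True by simp
    qed auto
    finally show ?thesis using True by auto
  qed auto
  show ?thesis using assms
    by (auto simp: predecessor_formula_def between_formula_def eq sum.delta)
qed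

lemma predecessor_formula_simps [simp]:
  "free_vars (predecessor_formula p) = {FO 0, SO p}"
  "letters (predecessor_formula p) = {}"
  by (auto simp: predecessor_formula_def between_formula_def)

lemma restricted_predecessor_formula:
  "finite X \<Longrightarrow> restricted X (predecessor_formula p)"
  by (simp add: predecessor_formula_def recognisable_step_function_between_formula)
    (simp add: between_formula_def)

definition state_formula :: "nat \<Rightarrow> nat \<Rightarrow> ('k :: comm_semiring_1, 'x) wmso" where
  "state_formula n q = prod_formula (\<lambda>p. if p = q then Elem 0 p else NotElem 0 p) [0..<n]"

lemma state_formula_simps [simp]:
  "wmso_value w \<sigma> \<tau> (state_formula n q) = of_bool (\<forall>p < n. \<sigma> 0 \<in> \<tau> p \<longleftrightarrow> p = q)"
  "free_vars (state_formula n q) = (if n = 0 then {} else insert (FO 0) (SO ` {..<n}))"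
  "letters (state_formula n q) = {}"
  "restricted X (state_formula n q)"
proof -
  have "wmso_value w \<sigma> \<tau> (state_formula n q) =
    (\<Prod>p \<leftarrow> [0..<n]. of_bool (\<sigma> 0 \<in> \<tau> p \<longleftrightarrow> p = q))"
    unfolding state_formula_def prod_formula_simps
    by (intro arg_cong[where f = prod_list] map_cong refl) auto
  then show "wmso_value w \<sigma> \<tau> (state_formula n q) = of_bool (\<forall>p < n. \<sigma> 0 \<in> \<tau> p \<longleftrightarrow> p = q)"
    by (simp add: prod_list_of_bool Ball_def)
qed (auto simp: state_formula_def split: if_splits)

text \<open>
  At the first position all predecessor formulas vanish and the weight is \<open>\<nu>\<close>; at any other
  position of a run exactly one of them holds and corrects \<open>\<nu>\<close> to \<open>\<mu>\<close>.
\<close>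

definition step_formula ::
    "'x list \<Rightarrow> nat \<Rightarrow> ('x \<Rightarrow> nat \<Rightarrow> 'k) \<Rightarrow> ('x \<Rightarrow> nat \<Rightarrow> nat \<Rightarrow> 'k :: field) \<Rightarrow> ('k, 'x) wmso" where
  "step_formula xs n \<nu> \<mu> =
     sum_formula (\<lambda>a. sum_formula (\<lambda>q. Conj (Letter a 0) (Conj (state_formula n q)
       (Disj (Const (\<nu> a q))
         (sum_formula (\<lambda>p. Conj (predecessor_formula p) (Const (\<mu> a p q - \<nu> a q))) [0..<n]))))
       [0..<n]) xs"

lemma step_formula_simps:
  "letters (step_formula xs n \<nu> \<mu>) \<subseteq> set xs"
  "xs \<noteq> [] \<Longrightarrow> n > 0 \<Longrightarrow> free_vars (step_formula xs n \<nu> \<mu>) = insert (FO 0) (SO ` {..<n})"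
  "finite X \<Longrightarrow> restricted X (step_formula xs n \<nu> \<mu>)"
  by (auto simp: step_formula_def restricted_predecessor_formula neq_Nil_conv)

lemma wmso_value_step_formula:
  assumes "\<sigma> 0 < length w" "distinct xs"
  shows "wmso_value w \<sigma> \<tau> (step_formula xs n \<nu> \<mu>) =
    (\<Sum>a \<in> set xs. \<Sum>q < n. of_bool (w ! \<sigma> 0 = a) * (of_bool (\<forall>p < n. \<sigma> 0 \<in> \<tau> p \<longleftrightarrow> p = q) *
      (\<nu> a q + (\<Sum>p < n. of_bool (\<sigma> 0 \<noteq> 0 \<and> \<sigma> 0 - 1 \<in> \<tau> p) * (\<mu> a p q - \<nu> a q)))))"
  using assms unfolding step_formula_def
  by (simp add: wmso_value_predecessor_formula sum_list_distinct_conv_sum_set atLeast0LessThan)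

lemma recognisable_step_function_step_formula:
  fixes \<nu> :: "'x \<Rightarrow> nat \<Rightarrow> 'k :: field"
  assumes "finite X" "distinct xs" "xs \<noteq> []" "n > 0"
  shows "recognisable_step_function (ext_alphabet X (free_vars (step_formula xs n \<nu> \<mu>)))
    (wmso_series (step_formula xs n \<nu> \<mu>))"
proof -
  define V where "V = insert (FO 0) (SO ` {..<n})"
  have V: "free_vars (step_formula xs n \<nu> \<mu>) = V"
    using assms by (simp add: step_formula_simps V_def)
  have enc: "encodes_assignment V u \<longleftrightarrow> (\<exists>!i. i \<in> marked_positions u (FO 0))" for u :: "('x \<times> var set) list"
    by (auto simp: encodes_assignment_def V_def)
  define G where "G = (\<lambda>(b :: 'x, U) l.
    (\<Sum>a \<in> set xs. \<Sum>q < n. of_bool (b = a) * (of_bool (\<forall>p < n. SO p \<in> U \<longleftrightarrow> p = q) *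
      (\<nu> a q + (\<Sum>p < n. of_bool (case l of None \<Rightarrow> False | Some (_ :: 'x, U') \<Rightarrow> SO p \<in> U') * (\<mu> a p q - \<nu> a q))))))"
  show ?thesis unfolding V
  proof (rule recognisable_step_function_of_marked_position[where P = "\<lambda>(b, U). FO 0 \<in> U" and G = G])
    show "finite (ext_alphabet X V)"
      using assms by (intro finite_ext_alphabet) (simp_all add: V_def)
    fix u :: "('x \<times> var set) list"
    have m: "{j. j < length u \<and> (case u ! j of (b, U) \<Rightarrow> FO 0 \<in> U)} = marked_positions u (FO 0)"
      by (auto simp: marked_positions_def)
    show "wmso_series (step_formula xs n \<nu> \<mu>) u = 0"
      if "card {j. j < length u \<and> (case u ! j of (b, U) \<Rightarrow> FO 0 \<in> U)} \<noteq> 1"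
      using that unfolding m by (simp add: wmso_series_def V enc ex1_marked_positions_iff)
    fix i assume "{j. j < length u \<and> (case u ! j of (b, U) \<Rightarrow> FO 0 \<in> U)} = {i}"
    then have i: "marked_positions u (FO 0) = {i}" unfolding m .
    have "i \<in> marked_positions u (FO 0)" by (simp add: i)
    then have len: "i < length u" "i - 1 < length u" by (auto simp: marked_positions_def)
    have the: "(THE j. j \<in> marked_positions u (FO 0)) = i" by (simp add: i)
    have enc_u: "encodes_assignment V u" by (simp add: enc i)
    have "wmso_series (step_formula xs n \<nu> \<mu>) u =
      (\<Sum>a \<in> set xs. \<Sum>q < n. of_bool (fst (u ! i) = a) *
       (of_bool (\<forall>p < n. i \<in> marked_positions u (SO p) \<longleftrightarrow> p = q) *
      (\<nu> a q + (\<Sum>p < n. of_bool (i \<noteq> 0 \<and> i - 1 \<in> marked_positions u (SO p)) * (\<mu> a p q - \<nu> a q)))))"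
      unfolding wmso_series_def V if_P[OF enc_u]
      by (subst wmso_value_step_formula[OF _ assms(2)])
        (use len in \<open>simp_all only: the length_map nth_map\<close>)
    also have "\<dots> = G (u ! i) (if i = 0 then None else Some (u ! (i - 1)))"
      using len by (simp add: G_def marked_positions_def split_beta)
    finally show "wmso_series (step_formula xs n \<nu> \<mu>) u = G (u ! i) (if i = 0 then None else Some (u ! (i - 1)))" .
  qed
qed

lemma sum_PiE_insert:
  assumes "x \<notin> A"
  shows "(\<Sum>f \<in> Pi\<^sub>E (insert x A) B. g f) = (\<Sum>f \<in> Pi\<^sub>E A B. \<Sum>y \<in> B x. g (f(x := y)))"
proof -
  have "(\<Sum>f \<in> Pi\<^sub>E (insert x A) B. g f) = (\<Sum>(y, f) \<in> B x \<times> Pi\<^sub>E A B. g (f(x := y)))"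
    unfolding PiE_insert_eq
    by (subst sum.reindex[OF inj_combinator[OF assms]]) (simp add: case_prod_unfold comp_def)
  also have "\<dots> = (\<Sum>f \<in> Pi\<^sub>E A B. \<Sum>y \<in> B x. g (f(x := y)))"
    by (subst sum.swap) (simp add: sum.cartesian_product)
  finally show ?thesis .
qed

lemma wmso_value_foldr_ExSO:
  "wmso_value w \<sigma> \<tau> (foldr ExSO [0..<n] \<phi>) =
   (\<Sum>I \<in> {..<n} \<rightarrow>\<^sub>E Pow {..<length w}. wmso_value w \<sigma> (\<lambda>Z. if Z < n then I Z else \<tau> Z) \<phi>)"
proof (induction n arbitrary: \<phi>)
  case (Suc n)
  have "wmso_value w \<sigma> \<tau> (foldr ExSO [0..<Suc n] \<phi>) =
    (\<Sum>I \<in> {..<n} \<rightarrow>\<^sub>E Pow {..<length w}. \<Sum>J \<in> Pow {..<length w}.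
      wmso_value w \<sigma> ((\<lambda>Z. if Z < n then I Z else \<tau> Z)(n := J)) \<phi>)"
    by (simp add: Suc.IH)
  also have "\<dots> = (\<Sum>I \<in> {..<n} \<rightarrow>\<^sub>E Pow {..<length w}. \<Sum>J \<in> Pow {..<length w}.
      wmso_value w \<sigma> (\<lambda>Z. if Z < Suc n then (I(n := J)) Z else \<tau> Z) \<phi>)"
    by (intro sum.cong refl arg_cong[where f = "\<lambda>\<tau>. wmso_value w \<sigma> \<tau> \<phi>"])
      (auto simp: fun_eq_iff less_Suc_eq)
  also have "\<dots> = (\<Sum>I \<in> {..<Suc n} \<rightarrow>\<^sub>E Pow {..<length w}. wmso_value w \<sigma> (\<lambda>Z. if Z < Suc n then I Z else \<tau> Z) \<phi>)"
    by (simp add: lessThan_Suc sum_PiE_insert)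
  finally show ?case .
qed simp

lemma foldr_ExSO_simps:
  "free_vars (foldr ExSO Zs \<phi>) = free_vars \<phi> - SO ` set Zs"
  "letters (foldr ExSO Zs \<phi>) = letters \<phi>"
  "restricted X (foldr ExSO Zs \<phi>) = restricted X \<phi>"
  by (induction Zs) auto


lemma sum_over_paths:
  fixes f :: "nat \<Rightarrow> nat \<Rightarrow> 'k :: comm_semiring_1"
  assumes "\<And>i q. i < m \<Longrightarrow> q < n \<Longrightarrow> f (Suc i) q = (\<Sum>p < n. f i p * g (Suc i) p q)"
  shows "(\<Sum>r \<in> {..m} \<rightarrow>\<^sub>E {..<n}. f 0 (r 0) * (\<Prod>i = 1..m. g i (r (i - 1)) (r i)) * h (r m)) =
    (\<Sum>q < n. f m q * h q)"
  using assms
proof (induction m arbitrary: h)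
  case 0
  show ?case using sum_PiE_insert[of 0 "{}" "\<lambda>r. f 0 (r 0) * h (r 0)" "\<lambda>_. {..<n}"] by simp
next
  case (Suc m)
  have upd: "(\<Prod>i = 1..m. g i ((r(Suc m := y)) (i - 1)) ((r(Suc m := y)) i)) = (\<Prod>i = 1..m. g i (r (i - 1)) (r i))" for r y
    by (rule prod.cong) auto
  have "(\<Sum>r \<in> {..Suc m} \<rightarrow>\<^sub>E {..<n}. f 0 (r 0) * (\<Prod>i = 1..Suc m. g i (r (i - 1)) (r i)) * h (r (Suc m))) =
    (\<Sum>r \<in> {..m} \<rightarrow>\<^sub>E {..<n}. \<Sum>y < n. f 0 (r 0) * (\<Prod>i = 1..m. g i (r (i - 1)) (r i)) *
      (g (Suc m) (r m) y * h y))"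
    unfolding atMost_Suc by (subst sum_PiE_insert) (simp_all add: upd[simplified] mult.assoc)
  also have "\<dots> = (\<Sum>q < n. f m q * (\<Sum>y < n. g (Suc m) q y * h y))"
    unfolding sum_distrib_left[symmetric] by (rule Suc.IH) (simp add: Suc.prems)
  also have "\<dots> = (\<Sum>y < n. (\<Sum>q < n. f m q * g (Suc m) q y) * h y)"
    unfolding sum_distrib_left sum_distrib_right by (subst sum.swap) (simp add: mult.assoc)
  also have "\<dots> = (\<Sum>q < n. f (Suc m) q * h q)"
    by (intro sum.cong refl) (simp add: Suc.prems)
  finally show ?case .
qed

definition run_formula ::
    "'x list \<Rightarrow> nat \<Rightarrow> ('x \<Rightarrow> nat \<Rightarrow> 'k) \<Rightarrow> ('x \<Rightarrow> nat \<Rightarrow> nat \<Rightarrow> 'k :: field) \<Rightarrow> ('k, 'x) wmso" where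
  "run_formula xs n \<nu> \<mu> = foldr ExSO [0..<n] (AllFO 0 (step_formula xs n \<nu> \<mu>))"

lemma run_formula_simps:
  fixes \<nu> :: "'x \<Rightarrow> nat \<Rightarrow> 'k :: field"
  assumes "distinct xs" "xs \<noteq> []" "n > 0"
  shows "free_vars (run_formula xs n \<nu> \<mu>) = {}"
    and "letters (run_formula xs n \<nu> \<mu>) \<subseteq> set xs"
    and "finite X \<Longrightarrow> restricted X (run_formula xs n \<nu> \<mu>)"
  using assms recognisable_step_function_step_formula[of X xs n \<nu> \<mu>]
  by (auto simp: run_formula_def foldr_ExSO_simps step_formula_simps
      dest: step_formula_simps(1)[THEN subsetD])

lemma wmso_value_run_formula:
  fixes \<nu> :: "'x \<Rightarrow> nat \<Rightarrow> 'k :: field"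
  assumes "distinct xs" and w: "length w = Suc m" "set w \<subseteq> set xs"
  shows "wmso_value w \<sigma> \<tau> (run_formula xs n \<nu> \<mu>) =
    (\<Sum>r \<in> {..m} \<rightarrow>\<^sub>E {..<n}. \<nu> (w ! 0) (r 0) * (\<Prod>i = 1..m. \<mu> (w ! i) (r (i - 1)) (r i)))"
proof -
  define state where "state = (\<lambda>(I :: nat \<Rightarrow> nat set) i q. \<forall>p < n. i \<in> I p \<longleftrightarrow> p = q)"
  define v where "v = (\<lambda>I i. \<Sum>q < n. of_bool (state I i q) *
      (\<nu> (w ! i) q + (\<Sum>p < n. of_bool (i \<noteq> 0 \<and> i - 1 \<in> I p) * (\<mu> (w ! i) p q - \<nu> (w ! i) q))))"
  have step: "wmso_value w (\<sigma>(0 := i)) \<tau>' (step_formula xs n \<nu> \<mu>) = v \<tau>' i" if "i \<le> m" for i \<tau>'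
  proof -
    have i: "i < length w" "w ! i \<in> set xs" using that w by (auto simp: subset_iff)
    have "wmso_value w (\<sigma>(0 := i)) \<tau>' (step_formula xs n \<nu> \<mu>) =
      (\<Sum>a \<in> set xs. if w ! i = a then v \<tau>' i else 0)"
    proof (subst wmso_value_step_formula)
      show "(\<Sum>a \<in> set xs. \<Sum>q < n. of_bool (w ! (\<sigma>(0 := i)) 0 = a) *
          (of_bool (\<forall>p < n. (\<sigma>(0 := i)) 0 \<in> \<tau>' p \<longleftrightarrow> p = q) * (\<nu> a q +
            (\<Sum>p < n. of_bool ((\<sigma>(0 := i)) 0 \<noteq> 0 \<and> (\<sigma>(0 := i)) 0 - 1 \<in> \<tau>' p) * (\<mu> a p q - \<nu> a q))))) =
        (\<Sum>a \<in> set xs. if w ! i = a then v \<tau>' i else 0)"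
        by (rule sum.cong[OF refl]) (auto simp: v_def state_def)
    qed (use i assms(1) in simp_all)
    then show ?thesis using i by simp
  qed
  have v_cong: "v I i = v I' i" if "\<And>p. p < n \<Longrightarrow> I p = I' p" for I I' i
    using that unfolding v_def state_def by (intro sum.cong refl arg_cong2[where f = "(*)"]) auto
  define D where "D = (\<lambda>r :: nat \<Rightarrow> nat. \<lambda>p \<in> {..<n}. {i. i \<le> m \<and> r i = p})"
  let ?R = "{..m} \<rightarrow>\<^sub>E {..<n}" and ?P = "{..<n} \<rightarrow>\<^sub>E Pow {..m}"
  have state_D: "state (D r) i q \<longleftrightarrow> q = r i" if "r \<in> ?R" "i \<le> m" "q < n" for r i q
  proof -
    have "r i < n" using that by auto
    then show ?thesis using that by (auto simp: state_def D_def)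
  qed
  have v_D: "v (D r) i = (if i = 0 then \<nu> (w ! 0) (r 0) else \<mu> (w ! i) (r (i - 1)) (r i))"
    if r: "r \<in> ?R" and i: "i \<le> m" for r i
  proof -
    have ri: "r i < n" "r (i - 1) < n" using r i by auto
    have "v (D r) i = (\<Sum>q < n. if q = r i then
      (\<nu> (w ! i) q + (\<Sum>p < n. of_bool (i \<noteq> 0 \<and> i - 1 \<in> D r p) * (\<mu> (w ! i) p q - \<nu> (w ! i) q))) else 0)"
      unfolding v_def by (intro sum.cong refl) (simp add: state_D[OF r i])
    also have "\<dots> = \<nu> (w ! i) (r i) + (\<Sum>p < n. of_bool (i \<noteq> 0 \<and> i - 1 \<in> D r p) * (\<mu> (w ! i) p (r i) - \<nu> (w ! i) (r i)))"
      using ri by simp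
    also have "(\<Sum>p < n. of_bool (i \<noteq> 0 \<and> i - 1 \<in> D r p) * (\<mu> (w ! i) p (r i) - \<nu> (w ! i) (r i))) =
      (\<Sum>p < n. if p = r (i - 1) then of_bool (i \<noteq> 0) * (\<mu> (w ! i) p (r i) - \<nu> (w ! i) (r i)) else 0)"
      using i by (intro sum.cong refl) (auto simp: D_def)
    also have "\<dots> = of_bool (i \<noteq> 0) * (\<mu> (w ! i) (r (i - 1)) (r i) - \<nu> (w ! i) (r i))"
      using ri by simp
    finally show ?thesis by simp
  qed
  have inj: "inj_on D ?R"
  proof (rule inj_onI)
    fix r r' assume r: "r \<in> ?R" "r' \<in> ?R" and eq: "D r = D r'"
    show "r = r'"
    proof (rule PiE_ext[OF r])
      fix i assume "i \<in> {..m}"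
      then show "r i = r' i" using state_D[OF r(1), of i "r i"] state_D[OF r(2), of i "r i"] eq r by auto
    qed
  qed
  have zero: "(\<Prod>i \<le> m. v I i) = 0" if I: "I \<in> ?P - D ` ?R" for I
  proof -
    have "\<exists>i \<le> m. \<forall>q < n. \<not> state I i q"
    proof (rule ccontr)
      assume "\<not> ?thesis"
      then have "\<forall>i \<in> {..m}. \<exists>q. q < n \<and> state I i q" by auto
      then obtain r where r: "\<forall>i \<in> {..m}. r i < n \<and> state I i (r i)" by (rule bchoice[THEN exE])
      have "D (restrict r {..m}) = I"
      proof (rule PiE_ext)
        show "D (restrict r {..m}) \<in> ?P" by (auto simp: D_def)
        show "I \<in> ?P" using I by blast
        fix p assume p: "p \<in> {..<n}"
        then have "I p \<subseteq> {..m}" using I by auto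
        then show "D (restrict r {..m}) p = I p"
          using p r by (auto simp: D_def state_def)
      qed
      moreover have "restrict r {..m} \<in> ?R" using r by auto
      ultimately show False using I by blast
    qed
    then obtain i where "i \<le> m" "\<forall>q < n. \<not> state I i q" by blast
    moreover from this have "v I i = 0" unfolding v_def by (intro sum.neutral) auto
    ultimately show ?thesis by (auto intro: prod_zero)
  qed
  have "wmso_value w \<sigma> \<tau> (run_formula xs n \<nu> \<mu>) = (\<Sum>I \<in> ?P. \<Prod>i \<le> m. v I i)"
    unfolding run_formula_def wmso_value_foldr_ExSO wmso_value.simps w lessThan_Suc_atMost
    by (intro sum.cong prod.cong refl) (auto simp: step intro!: v_cong)
  also have "\<dots> = (\<Sum>I \<in> D ` ?R. \<Prod>i \<le> m. v I i)"
    by (rule sum.mono_neutral_right) (use zero in \<open>auto simp: D_def intro: finite_PiE\<close>)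
  also have "\<dots> = (\<Sum>r \<in> ?R. \<Prod>i \<le> m. v (D r) i)"
    by (simp add: sum.reindex[OF inj])
  also have "\<dots> = (\<Sum>r \<in> ?R. \<nu> (w ! 0) (r 0) * (\<Prod>i = 1..m. \<mu> (w ! i) (r (i - 1)) (r i)))"
  proof (rule sum.cong[OF refl])
    fix r assume r: "r \<in> ?R"
    have "{..m} = insert 0 {1..m}" by auto
    then have "(\<Prod>i \<le> m. v (D r) i) = v (D r) 0 * (\<Prod>i = 1..m. v (D r) i)" by simp
    also have "(\<Prod>i = 1..m. v (D r) i) = (\<Prod>i = 1..m. \<mu> (w ! i) (r (i - 1)) (r i))"
      by (intro prod.cong refl) (simp add: v_D[OF r])
    finally show "(\<Prod>i \<le> m. v (D r) i) = \<nu> (w ! 0) (r 0) * (\<Prod>i = 1..m. \<mu> (w ! i) (r (i - 1)) (r i))"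
      by (simp add: v_D[OF r])
  qed
  finally show ?thesis .
qed

proposition rwMSO_definable_if_linear_recurrence:
  fixes F :: "'x list \<Rightarrow> nat \<Rightarrow> 'k :: field"
  assumes "finite X"
    and rec: "\<And>w a q. w \<in> lists X \<Longrightarrow> a \<in> X \<Longrightarrow> q < n \<Longrightarrow> F (w @ [a]) q = (\<Sum>p < n. F w p * \<mu> a p q)"
    and S: "\<And>w. w \<in> lists X \<Longrightarrow> S w = (\<Sum>q < n. F w q)"
  shows "rwMSO_definable X S"
proof (cases "X = {} \<or> n = 0")
  case True
  then have const: "S w = S []" if "w \<in> lists X" for w
    using that S by auto
  show ?thesis unfolding rwMSO_definable_def
    by (intro exI[of _ "Const (S [])"] conjI ballI) (simp_all add: const[symmetric])
next
  case False
  obtain xs where xs: "set xs = X" "distinct xs" using finite_distinct_list[OF \<open>finite X\<close>] by blast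
  have ne: "xs \<noteq> []" "n > 0" using False xs by auto
  let ?run = "run_formula xs n (\<lambda>a. F [a]) \<mu>"
  have run_Nil: "wmso_value [] \<sigma> \<tau> ?run = 1" for \<sigma> \<tau>
    by (simp add: run_formula_def wmso_value_foldr_ExSO card_PiE)
  have run: "wmso_value w \<sigma> \<tau> ?run = S w" if w: "w \<in> lists X" "w \<noteq> []" for w \<sigma> \<tau>
  proof -
    obtain m where m: "length w = Suc m" using w(2) by (cases w) auto
    have take: "take (Suc (Suc i)) w = take (Suc i) w @ [w ! Suc i]" if "i < m" for i
      using that m by (simp add: take_Suc_conv_app_nth)
    have "wmso_value w \<sigma> \<tau> ?run =
      (\<Sum>r \<in> {..m} \<rightarrow>\<^sub>E {..<n}. F [w ! 0] (r 0) * (\<Prod>i = 1..m. \<mu> (w ! i) (r (i - 1)) (r i)))"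
      by (rule wmso_value_run_formula[OF xs(2) m]) (use w xs(1) in auto)
    also have "[w ! 0] = take (Suc 0) w" using w(2) by (cases w) auto
    also have "(\<Sum>r \<in> {..m} \<rightarrow>\<^sub>E {..<n}. F (take (Suc 0) w) (r 0) * (\<Prod>i = 1..m. \<mu> (w ! i) (r (i - 1)) (r i))) =
      (\<Sum>q < n. F (take (Suc m) w) q)"
    proof -
      have "F (take (Suc (Suc i)) w) q = (\<Sum>p < n. F (take (Suc i) w) p * \<mu> (w ! Suc i) p q)"
        if "i < m" "q < n" for i q
        unfolding take[OF that(1)]
        by (rule rec) (use that m w in \<open>auto simp: in_lists_conv_set dest: in_set_takeD\<close>)
      from sum_over_paths[where h = "\<lambda>_. 1" and f = "\<lambda>i. F (take (Suc i) w)" and g = "\<lambda>i. \<mu> (w ! i)", OF this]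
      show ?thesis by simp
    qed
    also have "take (Suc m) w = w" using m by simp
    finally show ?thesis using S[OF w(1)] by simp
  qed
  \<comment> \<open>\<open>\<forall>x. 0\<close> has value \<open>1\<close> on the empty word and \<open>0\<close> on all others.\<close>
  let ?\<phi> = "Disj (Conj (Const (S [] - 1)) (AllFO 0 (Const 0))) ?run"
  have "recognisable_step_function (ext_alphabet X {}) (wmso_series (Const 0 :: ('k, 'x) wmso))"
    unfolding recognisable_step_function_def
    by (intro exI[of _ "[]"]) (simp add: wmso_series_def)
  then have "restricted X ?\<phi>" "letters ?\<phi> \<subseteq> X" "free_vars ?\<phi> = {}"
    using run_formula_simps[OF xs(2) ne, where \<nu> = "\<lambda>a. F [a]" and \<mu> = \<mu>] xs(1) \<open>finite X\<close> by simp_all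
  moreover have "S w = wmso_value w \<sigma> \<tau> ?\<phi>" if "w \<in> lists X" for w \<sigma> \<tau>
    using that run run_Nil by (cases w) simp_all
  ultimately show ?thesis unfolding rwMSO_definable_def by blast
qed


lemma carrier_free_algebra_closed:
  fixes p q :: "'x list \<Rightarrow>\<^sub>0 'k :: field"
  assumes "p \<in> carrier (free_algebra X)" "q \<in> carrier (free_algebra X)"
  shows "p + q \<in> carrier (free_algebra X)" "p * q \<in> carrier (free_algebra X)"
proof -
  interpret assoc_algebra "free_algebra X :: ('k, 'x list \<Rightarrow>\<^sub>0 'k) module"
    by (rule assoc_algebra_free_algebra)
  show "p + q \<in> carrier (free_algebra X)" "p * q \<in> carrier (free_algebra X)"
    using add.m_closed[OF assms] m_closed[OF assms] by (simp_all add: free_algebra_simps)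
qed

lemma single_in_carrier_free_algebra:
  "w \<in> lists X \<Longrightarrow> Poly_Mapping.single w k \<in> carrier (free_algebra X)"
  by (simp add: free_algebra_simps)

lemma linear_extension_single [simp]: "linear_extension S (Poly_Mapping.single w 1) = S w"
  by (simp add: linear_extension_def)

lemma linear_extension_scale:
  "linear_extension S (Poly_Mapping.single [] k * p) = k * linear_extension S p"
proof -
  have lookup: "Poly_Mapping.lookup (Poly_Mapping.single [] k * p) w = k * Poly_Mapping.lookup p w" for w
    unfolding mult_map_scale_conv_mult[of k p, symmetric, unfolded zero_list_def]
    by (simp add: map.rep_eq when_def)
  have "Poly_Mapping.keys (Poly_Mapping.single [] k * p) \<subseteq> Poly_Mapping.keys p"
    by (auto simp: in_keys_iff lookup)
  from linear_extension_superset[OF finite_keys this] show ?thesis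
    by (simp add: lookup linear_extension_def sum_distrib_left mult.assoc)
qed

definition linear_functional :: "'x set \<Rightarrow> (('x list \<Rightarrow>\<^sub>0 'k :: field) \<Rightarrow> 'k) \<Rightarrow> bool" where
  "linear_functional X L \<longleftrightarrow>
    (\<forall>p \<in> carrier (free_algebra X). \<forall>q \<in> carrier (free_algebra X). L (p + q) = L p + L q) \<and>
    (\<forall>k. \<forall>p \<in> carrier (free_algebra X). L (Poly_Mapping.single [] k * p) = k * L p)"

lemma linear_functionalD:
  assumes "linear_functional X L"
  shows "p \<in> carrier (free_algebra X) \<Longrightarrow> q \<in> carrier (free_algebra X) \<Longrightarrow> L (p + q) = L p + L q"
    and "p \<in> carrier (free_algebra X) \<Longrightarrow> L (Poly_Mapping.single [] k * p) = k * L p"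
  using assms by (simp_all add: linear_functional_def)

lemma linear_functional_combination:
  fixes L :: "('x list \<Rightarrow>\<^sub>0 'k :: field) \<Rightarrow> 'k"
  assumes L: "linear_functional X L" and "finite B" and e: "\<And>b. b \<in> B \<Longrightarrow> e b \<in> carrier (free_algebra X)"
  shows "(\<Sum>b \<in> B. Poly_Mapping.single [] (k b) * e b) \<in> carrier (free_algebra X)"
    and "L (\<Sum>b \<in> B. Poly_Mapping.single [] (k b) * e b) = (\<Sum>b \<in> B. k b * L (e b))"
proof -
  have zero: "0 \<in> carrier (free_algebra X)" by (simp add: free_algebra_simps)
  have L0: "L 0 = 0" using linear_functionalD(2)[OF L zero, of 0] by simp
  have "(\<Sum>b \<in> B. Poly_Mapping.single [] (k b) * e b) \<in> carrier (free_algebra X) \<and>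
    L (\<Sum>b \<in> B. Poly_Mapping.single [] (k b) * e b) = (\<Sum>b \<in> B. k b * L (e b))"
    using \<open>finite B\<close> e
    by (induction B rule: finite_induct)
      (simp_all add: zero L0 carrier_free_algebra_closed single_in_carrier_free_algebra linear_functionalD[OF L])
  then show "(\<Sum>b \<in> B. Poly_Mapping.single [] (k b) * e b) \<in> carrier (free_algebra X)"
    "L (\<Sum>b \<in> B. Poly_Mapping.single [] (k b) * e b) = (\<Sum>b \<in> B. k b * L (e b))" by auto
qed

lemma linear_functional_expand:
  fixes L :: "('x list \<Rightarrow>\<^sub>0 'k :: field) \<Rightarrow> 'k"
  assumes L: "linear_functional X L" and "finite B"
    and c: "\<And>b. b \<in> B \<Longrightarrow> linear_functional X (c b)"
    and e: "\<And>b. b \<in> B \<Longrightarrow> e b \<in> carrier (free_algebra X)"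
    and dual: "\<And>b b'. b \<in> B \<Longrightarrow> b' \<in> B \<Longrightarrow> c b' (e b) = of_bool (b' = b)"
    and vanish: "\<And>p. p \<in> carrier (free_algebra X) \<Longrightarrow> \<forall>b \<in> B. c b p = 0 \<Longrightarrow> L p = 0"
    and p: "p \<in> carrier (free_algebra X)"
  shows "L p = (\<Sum>b \<in> B. c b p * L (e b))"
proof -
  define s where "s = (\<Sum>b \<in> B. Poly_Mapping.single [] (- c b p) * e b)"
  have comb: "s \<in> carrier (free_algebra X)" "M s = (\<Sum>b \<in> B. - c b p * M (e b))"
    if "linear_functional X M" for M
    using linear_functional_combination[OF that \<open>finite B\<close> e] unfolding s_def by auto
  have s: "s \<in> carrier (free_algebra X)" by (rule comb(1)[OF L])
  have "c b (p + s) = 0" if b: "b \<in> B" for b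
  proof -
    have "c b s = (\<Sum>b' \<in> B. - c b' p * c b (e b'))" by (rule comb(2)[OF c[OF b]])
    also have "\<dots> = (\<Sum>b' \<in> B. if b' = b then - c b' p else 0)"
      by (intro sum.cong refl) (simp add: dual b)
    also have "\<dots> = - c b p" using b \<open>finite B\<close> by simp
    finally show ?thesis by (simp add: linear_functionalD[OF c[OF b]] p s)
  qed
  then have "L (p + s) = 0" by (intro vanish carrier_free_algebra_closed p s) simp
  then show ?thesis
    by (simp add: linear_functionalD[OF L] p s comb(2)[OF L] sum_negf)
qed

lemma rwMSO_definable_if_finite_codimension:
  fixes S :: "'x list \<Rightarrow> 'k :: field"
  assumes "finite X" "finite B"
    and c: "\<And>b. b \<in> B \<Longrightarrow> linear_functional X (c b)"
    and ker: "\<And>p. p \<in> carrier (free_algebra X) \<Longrightarrow> p \<in> syntactic_ideal X S \<longleftrightarrow> (\<forall>b \<in> B. c b p = 0)"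
    and e: "\<And>b. b \<in> B \<Longrightarrow> e b \<in> carrier (free_algebra X)"
    and dual: "\<And>b b'. b \<in> B \<Longrightarrow> b' \<in> B \<Longrightarrow> c b' (e b) = of_bool (b' = b)"
  shows "rwMSO_definable X S"
proof -
  let ?F = "free_algebra X :: ('k, 'x list \<Rightarrow>\<^sub>0 'k) module"
  interpret I: ideal "syntactic_ideal X S" ?F by (rule syntactic_ideal_greatest(1))
  define N where "N = card B"
  obtain f where "bij_betw f {0..<N} B"
    using ex_bij_betw_nat_finite[OF \<open>finite B\<close>] unfolding N_def by blast
  then have f: "bij_betw f {..<N} B" by (simp add: atLeast0LessThan)
  have fB: "f q \<in> B" if "q < N" for q using bij_betwE[OF f] that by blast
  \<comment> \<open>The last functional makes the sum of all of them equal to \<open>S\<close>, so that no final weights are needed.\<close>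
  define \<Phi> where "\<Phi> = (\<lambda>q p. if q < N then c (f q) p else linear_extension S p - (\<Sum>q < N. c (f q) p))"
  have \<Phi>_linear: "linear_functional X (\<Phi> q)" for q
  proof -
    have cf: "linear_functional X (c (f q))" if "q < N" for q using c fB that by blast
    show ?thesis unfolding linear_functional_def \<Phi>_def
      by (simp add: linear_functionalD[OF cf] linear_extension_add linear_extension_scale
          sum.distrib sum_distrib_left right_diff_distrib)
  qed
  have \<Phi>_vanish: "\<Phi> q p = 0" if "p \<in> syntactic_ideal X S" for q p
  proof -
    have "c b p = 0" if "b \<in> B" for b
      using ker[of p] \<open>p \<in> syntactic_ideal X S\<close> I.a_subset that by blast
    moreover have "linear_extension S p = 0" using syntactic_ideal_greatest(2) that by blast
    ultimately show ?thesis by (simp add: \<Phi>_def fB)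
  qed
  define \<mu> where "\<mu> = (\<lambda>a p q. if p < N then \<Phi> q (e (f p) * Poly_Mapping.single [a] 1) else 0)"
  show ?thesis
  proof (rule rwMSO_definable_if_linear_recurrence[OF \<open>finite X\<close>])
    fix w assume w: "w \<in> lists X"
    show "S w = (\<Sum>q < Suc N. \<Phi> q (Poly_Mapping.single w 1))" by (simp add: \<Phi>_def)
    fix a q assume a: "a \<in> X"
    let ?x = "Poly_Mapping.single [a] 1 :: 'x list \<Rightarrow>\<^sub>0 'k"
    have x: "?x \<in> carrier ?F" using a by (intro single_in_carrier_free_algebra) simp
    have "\<Phi> q (Poly_Mapping.single w 1 * ?x) = (\<Sum>b \<in> B. c b (Poly_Mapping.single w 1) * \<Phi> q (e b * ?x))"
    proof (rule linear_functional_expand[OF _ \<open>finite B\<close> c e dual])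
      show "linear_functional X (\<lambda>p. \<Phi> q (p * ?x))"
        unfolding linear_functional_def
        by (simp add: distrib_right mult.assoc x carrier_free_algebra_closed linear_functionalD[OF \<Phi>_linear])
      fix p assume "p \<in> carrier ?F" "\<forall>b \<in> B. c b p = 0"
      then have "p \<in> syntactic_ideal X S" using ker by blast
      from I.I_r_closed[OF this x] show "\<Phi> q (p * ?x) = 0"
        by (intro \<Phi>_vanish) (simp add: free_algebra_simps)
    qed (use w in \<open>auto intro: single_in_carrier_free_algebra\<close>)
    also have "\<dots> = (\<Sum>p < N. \<Phi> p (Poly_Mapping.single w 1) * \<mu> a p q)"
      unfolding sum.reindex_bij_betw[OF f, symmetric] by (simp add: \<Phi>_def \<mu>_def)
    finally show "\<Phi> q (Poly_Mapping.single (w @ [a]) 1) =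
      (\<Sum>p < Suc N. \<Phi> p (Poly_Mapping.single w 1) * \<mu> a p q)"
      by (simp add: mult_single plus_list_def \<mu>_def)
  qed
qed


definition matrix_index :: "nat list \<Rightarrow> (nat \<times> nat \<times> nat) set" where
  "matrix_index ns = (SIGMA i : {..<length ns}. {..<ns ! i} \<times> {..<ns ! i})"

definition matrix_entry :: "nat \<times> nat \<times> nat \<Rightarrow> (nat \<Rightarrow> 'k mat) \<Rightarrow> 'k" where
  "matrix_entry = (\<lambda>(i, r, s) M. M i $$ (r, s))"

lemma finite_matrix_index: "finite (matrix_index ns)"
  by (simp add: matrix_index_def)

lemma matrix_entry_linear:
  fixes M :: "nat \<Rightarrow> 'k :: field mat"
  assumes "b \<in> matrix_index ns" and M: "M \<in> carrier (matrix_product_algebra ns)"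
  shows "N \<in> carrier (matrix_product_algebra ns) \<Longrightarrow>
      matrix_entry b (M \<oplus>\<^bsub>matrix_product_algebra ns\<^esub> N) = matrix_entry b M + matrix_entry b N"
    and "matrix_entry b (k \<odot>\<^bsub>matrix_product_algebra ns\<^esub> M) = k * matrix_entry b M"
proof -
  obtain i r s where b: "b = (i, r, s)" "i < length ns" "r < ns ! i" "s < ns ! i"
    using assms(1) by (auto simp: matrix_index_def)
  have mat: "K i \<in> carrier_mat (ns ! i) (ns ! i)" if "K \<in> carrier (matrix_product_algebra ns)"
    for K :: "nat \<Rightarrow> 'k mat"
    using that b by (auto simp: matrix_product_algebra_def)
  show "matrix_entry b (k \<odot>\<^bsub>matrix_product_algebra ns\<^esub> M) = k * matrix_entry b M"
    using b mat[OF M] by (simp add: matrix_product_algebra_def matrix_entry_def)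
  show "matrix_entry b (M \<oplus>\<^bsub>matrix_product_algebra ns\<^esub> N) = matrix_entry b M + matrix_entry b N"
    if "N \<in> carrier (matrix_product_algebra ns)"
    using b mat[OF M] mat[OF that] by (simp add: matrix_product_algebra_def matrix_entry_def)
qed

lemma matrix_product_eqI:
  assumes M: "M \<in> carrier (matrix_product_algebra ns)" and N: "N \<in> carrier (matrix_product_algebra ns)"
    and eq: "\<And>b. b \<in> matrix_index ns \<Longrightarrow> matrix_entry b M = matrix_entry b N"
  shows "M = N"
proof -
  let ?P = "\<Pi>\<^sub>E i \<in> {..<length ns}. carrier_mat (ns ! i) (ns ! i)"
  have MN: "M \<in> ?P" "N \<in> ?P" using M N by (simp_all add: matrix_product_algebra_def)
  show ?thesis
  proof (rule PiE_ext[OF MN])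
    fix i assume i: "i \<in> {..<length ns}"
    then have "M i \<in> carrier_mat (ns ! i) (ns ! i)" "N i \<in> carrier_mat (ns ! i) (ns ! i)"
      using MN by auto
    then show "M i = N i"
      using i eq[of "(i, r, s)" for r s] by (intro eq_matI) (auto simp: matrix_index_def matrix_entry_def)
  qed
qed

lemma ex_matrix_unit:
  assumes "b \<in> matrix_index ns"
  shows "\<exists>E \<in> carrier (matrix_product_algebra ns :: ('k :: field, _) module).
    \<forall>b' \<in> matrix_index ns. matrix_entry b' E = of_bool (b' = b)"
proof
  let ?E = "\<lambda>i \<in> {..<length ns}. mat (ns ! i) (ns ! i) (\<lambda>(r, s). of_bool ((i, r, s) = b)) :: 'k mat"
  show "?E \<in> carrier (matrix_product_algebra ns)" by (auto simp: matrix_product_algebra_def)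
  show "\<forall>b' \<in> matrix_index ns. matrix_entry b' ?E = of_bool (b' = b)"
    by (auto simp: matrix_index_def matrix_entry_def)
qed

theorem proposition3p3:
  fixes A :: "('k :: {alg_closed_field, field_char_0}, 'a) module"
    and X :: "'x set"
    and S :: "'x list \<Rightarrow> 'k"
  assumes "fd_semisimple_algebra A"
    and "finite X"
    and "algebra_isomorphic (syntactic_algebra X S) A"
  shows "rwMSO_definable X S"
proof -
  let ?F = "free_algebra X :: ('k, 'x list \<Rightarrow>\<^sub>0 'k) module"
  let ?I = "syntactic_ideal X S" and ?Q = "syntactic_algebra X S"
  obtain ns where ns: "algebra_isomorphic A (matrix_product_algebra ns)"
    using assms(1) unfolding fd_semisimple_algebra_def by blast
  let ?M = "matrix_product_algebra ns :: ('k, nat \<Rightarrow> 'k mat) module"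
  interpret F: assoc_algebra ?F by (rule assoc_algebra_free_algebra)
  interpret I: ideal ?I ?F by (rule syntactic_ideal_greatest(1))
  obtain g where g: "g \<in> ring_iso ?Q A" "\<forall>k. \<forall>x \<in> carrier ?Q. g (k \<odot>\<^bsub>?Q\<^esub> x) = k \<odot>\<^bsub>A\<^esub> g x"
    using assms(3) unfolding algebra_isomorphic_def by blast
  obtain h where h: "h \<in> ring_iso A ?M" "\<forall>k. \<forall>x \<in> carrier A. h (k \<odot>\<^bsub>A\<^esub> x) = k \<odot>\<^bsub>?M\<^esub> h x"
    using ns unfolding algebra_isomorphic_def by blast
  have gh_bij: "bij_betw (h \<circ> g) (carrier ?Q) (carrier ?M)"
    using ring_iso_memE(5)[OF g(1)] ring_iso_memE(5)[OF h(1)] by (rule bij_betw_trans)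
  define coset where "coset p = ?I +>\<^bsub>?F\<^esub> p" for p
  have carrier_Q: "carrier ?Q = coset ` carrier ?F"
    by (auto simp: syntactic_algebra_def quotient_algebra_simps A_RCOSETS_def' coset_def)
  have coset_add: "coset (p + q) = coset p \<oplus>\<^bsub>?Q\<^esub> coset q" if "p \<in> carrier ?F" "q \<in> carrier ?F" for p q
    using I.a_rcos_sum[OF that]
    by (simp add: syntactic_algebra_def quotient_algebra_simps coset_def free_algebra_simps)
  have coset_smult: "coset (Poly_Mapping.single [] k * p) = k \<odot>\<^bsub>?Q\<^esub> coset p" if "p \<in> carrier ?F" for k p
    using quotient_algebra_smult_coset[OF F.assoc_algebra_axioms I.ideal_axioms that]
    by (simp add: syntactic_algebra_def coset_def free_algebra_simps)
  define H where "H p = h (g (coset p))" for p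
  have coset_closed: "coset p \<in> carrier ?Q" if "p \<in> carrier ?F" for p
    using that by (auto simp: carrier_Q)
  have g_closed: "g (coset p) \<in> carrier A" if "p \<in> carrier ?F" for p
    using ring_iso_memE(1)[OF g(1) coset_closed[OF that]] .
  have H_closed: "H p \<in> carrier ?M" if "p \<in> carrier ?F" for p
    unfolding H_def using ring_iso_memE(1)[OF h(1) g_closed[OF that]] .
  have H_add: "H (p + q) = H p \<oplus>\<^bsub>?M\<^esub> H q" if "p \<in> carrier ?F" "q \<in> carrier ?F" for p q
    by (simp add: H_def that coset_add ring_iso_memE(3)[OF g(1)] ring_iso_memE(3)[OF h(1)] coset_closed g_closed)
  have H_smult: "H (Poly_Mapping.single [] k * p) = k \<odot>\<^bsub>?M\<^esub> H p" if "p \<in> carrier ?F" for k p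
    by (simp add: H_def that coset_smult g(2) h(2) coset_closed g_closed)
  have H_eq_iff: "H p = H q \<longleftrightarrow> coset p = coset q" if "p \<in> carrier ?F" "q \<in> carrier ?F" for p q
    using inj_on_eq_iff[OF bij_betw_imp_inj_on[OF gh_bij] coset_closed coset_closed] that
    by (simp add: H_def)
  have H_surj: "\<exists>p \<in> carrier ?F. H p = N" if "N \<in> carrier ?M" for N
  proof -
    have "N \<in> (h \<circ> g) ` carrier ?Q" using that bij_betw_imp_surj_on[OF gh_bij] by blast
    then show ?thesis by (auto simp: carrier_Q H_def)
  qed
  have linear: "linear_functional X (\<lambda>p. matrix_entry b (H p))" if "b \<in> matrix_index ns" for b
    unfolding linear_functional_def
    by (simp add: H_add H_smult matrix_entry_linear[OF that] H_closed)
  have zero: "0 \<in> carrier ?F" by (simp add: free_algebra_simps)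
  have "\<exists>e. e \<in> carrier ?F \<and> (\<forall>b' \<in> matrix_index ns. matrix_entry b' (H e) = of_bool (b' = b))"
    if "b \<in> matrix_index ns" for b
    using ex_matrix_unit[OF that] H_surj by blast
  then obtain e where e: "e b \<in> carrier ?F"
    "\<forall>b' \<in> matrix_index ns. matrix_entry b' (H (e b)) = of_bool (b' = b)" if "b \<in> matrix_index ns" for b
    by metis
  have dual: "matrix_entry b' (H (e b)) = of_bool (b' = b)"
    if "b \<in> matrix_index ns" "b' \<in> matrix_index ns" for b b'
    using e(2)[OF that(1)] that(2) by blast
  show ?thesis
  proof (rule rwMSO_definable_if_finite_codimension[where e = e, OF \<open>finite X\<close> finite_matrix_index linear])
    fix p assume p: "p \<in> carrier ?F"
    have entry_0: "matrix_entry b (H 0) = 0" if "b \<in> matrix_index ns" for b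
      using linear_functionalD(2)[OF linear[OF that] zero, of 0] by simp
    have "p \<in> ?I \<longleftrightarrow> coset p = coset 0"
    proof -
      have "coset 0 = ?I"
        using F.a_coset_join2[OF zero I.a_subgroup] I.zero_closed
        by (simp add: coset_def free_algebra_simps)
      then show ?thesis
        using I.a_rcos_const[of p] I.a_rcos_self[OF p] unfolding coset_def by auto
    qed
    also have "\<dots> \<longleftrightarrow> H p = H 0" by (simp add: H_eq_iff p zero)
    also have "\<dots> \<longleftrightarrow> (\<forall>b \<in> matrix_index ns. matrix_entry b (H p) = 0)"
      using entry_0 matrix_product_eqI[OF H_closed[OF p] H_closed[OF zero]] by auto
    finally show "p \<in> ?I \<longleftrightarrow> (\<forall>b \<in> matrix_index ns. matrix_entry b (H p) = 0)" .
  qed (use e(1) dual in simp_all)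
qed

end
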